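(* Let $0\le m,h\le n$, $0\le k\le\min\{n-m,m\}$, $0\le i\le h/2$, $0\le j\le(n-h)/2$, $k-h\le j-i\le n-h-k$ and $i+j\le k$. Let $A=\{1,\dots,h\}$, $B=\{h+1,\dots,n\}$, with $S_{n-h}\times S_h$ the stabilizer of $A$ in $S_n$. Define the linear map $T_m:S^{h-i,i}(A)\otimes S^{n-h-j,j}(B)\to M^{n-m,m}$ by $$T_m(\phi\otimes\psi)=\sum_{w=\max\{j,i-h+m\}}^{\min\{n-h-j,m-i\}}E_{k-i-j}(n-h-2j,\,h-2i,\,m-i-j,\,w-j)\,(R_{m-w-i}\phi)\otimes(R_{w-j}\psi).$$ Then $T_m$ is an injective $S_{n-h}\times S_h$-equivariant map of $S^{h-i,i}(A)\otimes S^{n-h-j,j}(B)$ into $\mathrm{Res}^{S_n}_{S_{n-h}\times S_h}\left[R_{m-k}S^{n-k,k}\right]$. Moreover, for $\phi\in S^{h-i,i}(A)$, $\psi\in S^{n-h-j,j}(B)$, $$\begin{aligned}\lVert T_m(\phi\otimes\psi)\rVert^2_{M^{n-m,m}}=&\binom{n-2i-2j}{m-i-j}\binom{n-2i-2j}{k-i-j}^{-1}\frac{n-i-j-k+1}{n-2k+1}\,(n-h-j-k+i+1)_{k-i-j}\\&\times(h-i-k+j+1)_{k-i-j}\,(m-k+1)_{k-i-j}\,(n-m-k+1)_{k-i-j}\,\lVert\phi\rVert^2_{M^{h-i,i}(A)}\lVert\psi\rVert^2_{M^{n-h-j,j}(B)}.\end{aligned}$$ Finally, for every integer $q\ge0$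 with $m+q\le n-k$, $$R_qT_m=\binom{m-k+q}{q}T_{m+q}.$$
   Context: For a finite set $X$ with $|X|=t$ and $0\le j\le t$, $M^{t-j,j}(X)$ is the space of complex functions on the set of $j$-subsets of $X$ (a permutation module of $\mathrm{Sym}(X)$), with inner product $\langle f_1,f_2\rangle=\sum_C f_1(C)\overline{f_2(C)}$ and Dirac functions $\delta_C$; spaces with $j<0$ or $j>t$ are $0$. Define linear maps $d\delta_C=\sum_{x\in C}\delta_{C\setminus\{x\}}$ and, for $q\ge0$, $R_q\delta_C=\sum_{D\supseteq C,\ |D|=|C|+q}\delta_D$ ($D\subseteq X$). For $0\le j\le t/2$, $S^{t-j,j}(X)=M^{t-j,j}(X)\cap\mathrm{Ker}\,d$, an irreducible representation of $\mathrm{Sym}(X)$. When $X=\{1,\dots,n\}$ write $M^{n-m,m}$, $S^{n-k,k}$. If $F$ is a function on $p$-subsets of $A$ and $G$ a function on $q$-subsets of $B$ ($A,B$ disjoint), $F\otimes G$ is the function on $(p+q)$-subsets $Z$ of $A\cup B$ equal to $F(Z\cap A)G(Z\cap B)$ if $|Z\cap A|=p$ and $0$ otherwise. Hahn polynomials: for integers with $0\le c\le a+b$, $0\le m\le\min\{a,b,c,a+b-c\}$, $\max\{c-b,0\}\le x\le\min\{a,c\}$, $$E_m(a,b,c,x)=\sum_{r=\max\{0,x-c+m\}}^{\min\{m,x\}}(-1)^r\binom{m}{r}(b-m+1)_r(-x)_r(a-m+1)_{m-r}(x-c)_{m-r},$$ where $(x)_s=x(x+1)\cdots(x+s-1)$.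 *)

theory Defs
  imports
    Complex_Main
    "HOL-Library.Function_Algebras"
    "HOL-Combinatorics.Permutations"
begin

definition fscale :: "complex \<Rightarrow> ('a \<Rightarrow> complex) \<Rightarrow> ('a \<Rightarrow> complex)" where
  "fscale c f = (\<lambda>x. c * f x)"

global_interpretation fun_vs: vector_space "fscale :: complex \<Rightarrow> ('a \<Rightarrow> complex) \<Rightarrow> ('a \<Rightarrow> complex)"
  by unfold_locales (auto simp: fscale_def algebra_simps)

definition linear_map_on :: "('a \<Rightarrow> complex) set \<Rightarrow> (('a \<Rightarrow> complex) \<Rightarrow> ('b \<Rightarrow> complex)) \<Rightarrow> bool" where
  "linear_map_on V T \<longleftrightarrow>
     (\<forall>f\<in>V. \<forall>g\<in>V. T (f + g) = T f + T g) \<and> (\<forall>c. \<forall>f\<in>V. T (fscale c f) = fscale c (T f))"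

definition dirac :: "'a set \<Rightarrow> 'a set \<Rightarrow> complex" where
  "dirac C = (\<lambda>D. if D = C then 1 else 0)"

text \<open>
  \<open>perm_mod X j\<close> is \<open>M\<^sup>t\<^sup>-\<^sup>j\<^sup>,\<^sup>j(X)\<close> with \<open>t = card X\<close>. A function on the \<open>j\<close>-subsets of \<open>X\<close> is represented by
  its extension by zero to all sets, so that \<open>perm_mod X j\<close> is the zero space when \<open>j > card X\<close>.
\<close>
definition perm_mod :: "'a set \<Rightarrow> nat \<Rightarrow> ('a set \<Rightarrow> complex) set" where
  "perm_mod X j = {f. \<forall>C. f C \<noteq> 0 \<longrightarrow> C \<subseteq> X \<and> card C = j}"

definition M_inner :: "'a set \<Rightarrow> nat \<Rightarrow> ('a set \<Rightarrow> complex) \<Rightarrow> ('a set \<Rightarrow> complex) \<Rightarrow> complex" where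
  "M_inner X j f g = (\<Sum>C | C \<subseteq> X \<and> card C = j. f C * cnj (g C))"

definition M_norm :: "'a set \<Rightarrow> nat \<Rightarrow> ('a set \<Rightarrow> complex) \<Rightarrow> real" where
  "M_norm X j f = sqrt (Re (M_inner X j f f))"

text \<open>
  The maps \<open>d\<close> and \<open>R\<^sub>q\<close> are the linear extensions of their prescriptions on Dirac functions; they are
  defined simultaneously on all \<open>perm_mod X j\<close>.
\<close>
definition d_map :: "'a set \<Rightarrow> ('a set \<Rightarrow> complex) \<Rightarrow> ('a set \<Rightarrow> complex)" where
  "d_map X f = (\<Sum>C\<in>Pow X. fscale (f C) (\<Sum>x\<in>C. dirac (C - {x})))"

definition R_map :: "'a set \<Rightarrow> nat \<Rightarrow> ('a set \<Rightarrow> complex) \<Rightarrow> ('a set \<Rightarrow> complex)" where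
  "R_map X q f =
     (\<Sum>C\<in>Pow X. fscale (f C) (\<Sum>D | C \<subseteq> D \<and> D \<subseteq> X \<and> card D = card C + q. dirac D))"

text \<open>\<open>specht X j\<close> is \<open>S\<^sup>t\<^sup>-\<^sup>j\<^sup>,\<^sup>j(X)\<close>; it is meant for \<open>2 * j \<le> card X\<close> only.\<close>
definition specht :: "'a set \<Rightarrow> nat \<Rightarrow> ('a set \<Rightarrow> complex) set" where
  "specht X j = {f \<in> perm_mod X j. d_map X f = 0}"

definition perm_act :: "('a \<Rightarrow> 'a) \<Rightarrow> ('a set \<Rightarrow> complex) \<Rightarrow> ('a set \<Rightarrow> complex)" where
  "perm_act \<pi> f = (\<lambda>C. f (inv \<pi> ` C))"

definition set_stabilizer :: "'a set \<Rightarrow> 'a set \<Rightarrow> ('a \<Rightarrow> 'a) set" where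
  "set_stabilizer X A = {\<pi>. \<pi> permutes X \<and> \<pi> ` A = A}"

definition tensor ::
  "'a set \<Rightarrow> nat \<Rightarrow> 'a set \<Rightarrow> nat \<Rightarrow> ('a set \<Rightarrow> complex) \<Rightarrow> ('a set \<Rightarrow> complex) \<Rightarrow> ('a set \<Rightarrow> complex)" where
  "tensor A p B q F G =
     (\<lambda>Z. if Z \<subseteq> A \<union> B \<and> card Z = p + q \<and> card (Z \<inter> A) = p then F (Z \<inter> A) * G (Z \<inter> B) else 0)"

text \<open>
  The tensor product \<open>S\<^sup>s\<^sup>-\<^sup>i\<^sup>,\<^sup>i(A) \<otimes> S\<^sup>t\<^sup>-\<^sup>j\<^sup>,\<^sup>j(B)\<close> is realised as the complex span of the functions
  \<open>\<phi> \<otimes> \<psi>\<close> on the \<open>(i + j)\<close>-subsets of \<open>A \<union> B\<close>. By the two lemmas that follow, the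
  outer tensor product action of \<open>Sym(A) \<times> Sym(B)\<close> on it is the permutation action \<open>perm_act\<close>.
\<close>
definition specht_tensor :: "'a set \<Rightarrow> nat \<Rightarrow> 'a set \<Rightarrow> nat \<Rightarrow> ('a set \<Rightarrow> complex) set" where
  "specht_tensor A i B j = fun_vs.span {tensor A i B j \<phi> \<psi> | \<phi> \<psi>. \<phi> \<in> specht A i \<and> \<psi> \<in> specht B j}"

lemma perm_act_dirac:
  assumes "bij \<pi>"
  shows "perm_act \<pi> (dirac C) = dirac (\<pi> ` C)"
proof
  fix D
  have "inv \<pi> ` D = C \<longleftrightarrow> D = \<pi> ` C"
    using assms by (metis bij_def image_inv_f_f image_f_inv_f)
  then show "perm_act \<pi> (dirac C) D = dirac (\<pi> ` C) D"
    by (simp add: perm_act_def dirac_def)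
qed

lemma perm_act_tensor:
  assumes s: "\<sigma> permutes A" and t: "\<tau> permutes B" and AB: "A \<inter> B = {}"
  shows "perm_act (\<sigma> \<circ> \<tau>) (tensor A p B q F G) = tensor A p B q (perm_act \<sigma> F) (perm_act \<tau> G)"
proof
  fix Z
  define g where "g = inv (\<sigma> \<circ> \<tau>)"
  have g: "g = inv \<tau> \<circ> inv \<sigma>"
    unfolding g_def using s t by (simp add: o_inv_distrib permutes_bij)
  have is0: "inv \<sigma> permutes A" and it: "inv \<tau> permutes B"
    using s t by (simp_all add: permutes_inv)
  have s': "inv \<sigma> x \<in> A \<longleftrightarrow> x \<in> A" "x \<notin> A \<Longrightarrow> inv \<sigma> x = x" for x
    using is0 by (simp_all add: permutes_in_image permutes_not_in)
  have t': "inv \<tau> x \<in> B \<longleftrightarrow> x \<in> B" "x \<notin> B \<Longrightarrow> inv \<tau> x = x" for x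
    using it by (simp_all add: permutes_in_image permutes_not_in)
  have sB: "inv \<sigma> x \<in> B \<longleftrightarrow> x \<in> B" for x
    using s'[of x] AB by (cases "x \<in> A") auto
  have tA: "inv \<tau> x \<in> A \<longleftrightarrow> x \<in> A" for x
    using t'[of x] AB by (cases "x \<in> B") auto
  have gin: "g x \<in> A \<longleftrightarrow> x \<in> A" "g x \<in> B \<longleftrightarrow> x \<in> B" for x
    by (simp_all add: g s'(1) t'(1) sB tA)
  have gA: "g x = inv \<sigma> x" if "x \<in> A" for x
  proof -
    have "inv \<sigma> x \<notin> B" using that AB s'(1)[of x] by auto
    then show ?thesis by (simp add: g t'(2))
  qed
  have gB: "g x = inv \<tau> x" if "x \<in> B" for x
  proof -
    have "x \<notin> A" using that AB by auto
    then show ?thesis by (simp add: g s'(2))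
  qed
  have injg: "inj g"
    unfolding g using is0 it by (simp add: inj_compose permutes_inj)
  have c: "card (g ` W) = card W" for W
    by (rule card_image) (rule inj_on_subset[OF injg subset_UNIV])
  have 1: "g ` Z \<inter> A = g ` (Z \<inter> A)" "g ` Z \<inter> B = g ` (Z \<inter> B)"
    using gin by blast+
  have 2: "g ` (Z \<inter> A) = inv \<sigma> ` (Z \<inter> A)" "g ` (Z \<inter> B) = inv \<tau> ` (Z \<inter> B)"
    using gA gB by (simp_all cong: image_cong_simp)
  have 3: "g ` Z \<subseteq> A \<union> B \<longleftrightarrow> Z \<subseteq> A \<union> B"
    using gin by blast
  show "perm_act (\<sigma> \<circ> \<tau>) (tensor A p B q F G) Z = tensor A p B q (perm_act \<sigma> F) (perm_act \<tau> G) Z"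
    unfolding perm_act_def g_def[symmetric] tensor_def 1 c 3 2[symmetric] by simp
qed

text \<open>
  The Hahn polynomial \<open>E\<^sub>m(a, b, c, x)\<close>, an integer. It is meant for \<open>c \<le> a + b\<close>,
  \<open>m \<le> min {a, b, c, a + b - c}\<close> and \<open>max {c - b, 0} \<le> x \<le> min {a, c}\<close>. The truncated subtraction
  \<open>x + m - c\<close> is exactly \<open>max {0, x - c + m}\<close>.
\<close>
definition hahn :: "nat \<Rightarrow> nat \<Rightarrow> nat \<Rightarrow> nat \<Rightarrow> nat \<Rightarrow> int" where
  "hahn m a b c x =
     (\<Sum>r = x + m - c..min m x.
        (- 1) ^ r * int (m choose r)
        * pochhammer (int b - int m + 1) r * pochhammer (- int x) r
        * pochhammer (int a - int m + 1) (m - r) * pochhammer (int x - int c) (m - r))"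

text \<open>
  \<open>is_T n h k i j m T\<close>: \<open>T\<close> is the linear map \<open>T\<^sub>m\<close>. Under the standing assumptions of the theorem none
  of the natural-number subtractions below truncates, except \<open>m + i - h\<close>, whose truncation at \<open>0\<close> is
  harmless as it occurs in \<open>max j (m + i - h)\<close>.
\<close>
definition is_T ::
  "nat \<Rightarrow> nat \<Rightarrow> nat \<Rightarrow> nat \<Rightarrow> nat \<Rightarrow> nat \<Rightarrow> ((nat set \<Rightarrow> complex) \<Rightarrow> (nat set \<Rightarrow> complex)) \<Rightarrow> bool" where
  "is_T n h k i j m T \<longleftrightarrow>
     (let A = {1..h}; B = {h+1..n} in
       T ` specht_tensor A i B j \<subseteq> perm_mod {1..n} m \<and>
       linear_map_on (specht_tensor A i B j) T \<and>
       (\<forall>\<phi>\<in>specht A i. \<forall>\<psi>\<in>specht B j.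
          T (tensor A i B j \<phi> \<psi>) =
            (\<Sum>w = max j (m + i - h)..min (n - h - j) (m - i).
               fscale (of_int (hahn (k - i - j) (n - h - 2 * j) (h - 2 * i) (m - i - j) (w - j)))
                 (tensor A (m - w) B w (R_map A (m - w - i) \<phi>) (R_map B (w - j) \<psi>)))))"

end

theory Submission
  imports Defs
begin

text \<open>
  Write \<open>(\<zeta> F)(Z)\<close> for the sum of \<open>F\<close> over all subsets of \<open>Z\<close>. If \<open>f\<close> lives on \<open>p\<close>-sets, then \<open>R\<^sub>q f\<close> is just
  \<open>\<zeta> f\<close> restricted to sets of size \<open>p + q\<close>, and \<open>\<zeta>\<close> turns a tensor product into a product. Hence every term
  in the definition of \<open>T\<^sub>m\<close> is the same function \<open>\<zeta> F\<close> cut out by a condition on \<open>Z \<inter> B\<close>, and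
  \<open>T\<^sub>m F (Z) = E(|Z \<inter> B| - j) (\<zeta> F)(Z)\<close> for \<open>|Z| = m\<close>. This formula makes sense for all \<open>F\<close>, so that
  existence, linearity and equivariance are immediate. Two facts give the rest.

  First, suppose that \<open>d \<phi> = 0\<close> for a function \<open>\<phi>\<close> on \<open>i\<close>-sets of \<open>A\<close>. Then summing \<open>\<zeta> \<phi>\<close> over the
  one-point extensions of \<open>Z\<close> multiplies \<open>(\<zeta> \<phi>)(Z)\<close> by \<open>|A| - |Z| - i\<close> (\<open>sum_insert_zeta_specht\<close>). Iteration
  gives all sums of \<open>\<zeta> \<phi>\<close> over supersets (\<open>sum_supersets_zeta_specht\<close>). Taken above the \<open>i\<close>-sets they compute
  \<open>\<parallel>R\<^sub>q \<phi>\<parallel>\<^sup>2 = (|A| - 2 i choose q) \<parallel>\<phi>\<parallel>\<^sup>2\<close>, hence also the vanishing of \<open>R\<^sub>q \<phi>\<close> for \<open>q > |A| - 2 i\<close>, which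
  justifies the formula for \<open>T\<^sub>m\<close> when \<open>|Z \<inter> B|\<close> is out of the range of summation. They also show that \<open>R\<^sub>q\<close> is
  injective on the kernel of \<open>d\<close> for \<open>q \<le> |A| - 2 i\<close>.

  Second, with \<open>K = k - i - j\<close>, \<open>a = |B| - 2 j\<close>, \<open>b = |A| - 2 i\<close>, \<open>c = m - i - j\<close> and \<open>e\<^sub>r = E\<^sub>K(a, b, K, r)\<close>, the Hahn polynomial is
  \<open>E\<^sub>K(a, b, c, x) = (\<Sum>r. e\<^sub>r (x choose r) (c - x choose K - r))\<close>, where the \<open>e\<^sub>r\<close> are plain products
  (\<open>hahn_eq_sum_lead_hahn\<close>). The two binomials count the \<open>k\<close>-sets \<open>Y\<close> with \<open>C \<subseteq> Y \<subseteq> Z\<close> and \<open>|Y \<inter> B| = j + r\<close>,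
  so \<open>T\<^sub>m = R\<^sub>m\<^sub>-\<^sub>k T\<^sub>k\<close> (\<open>R_map_intertwiner\<close>). The formula for \<open>R\<^sub>q T\<^sub>m\<close> is then the composition law
  \<open>R\<^sub>q R\<^sub>p = (p + q choose q) R\<^sub>p\<^sub>+\<^sub>q\<close>, and since the norm
  and the injectivity of \<open>R\<^sub>m\<^sub>-\<^sub>k\<close> on \<open>S\<^sup>n\<^sup>-\<^sup>k\<^sup>,\<^sup>k\<close> are known, only \<open>m = k\<close> is left to understand.

  For \<open>m = k\<close> the ratio of consecutive \<open>e\<^sub>r\<close> is exactly the one which cancels the two kinds of one-point extensions,
  inside \<open>A\<close> and inside \<open>B\<close>, so \<open>d T\<^sub>k F = 0\<close>. The norm of \<open>T\<^sub>k (\<phi> \<otimes> \<psi>)\<close> splits according to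
  \<open>|Z \<inter> B| = j + r\<close> into a sum over \<open>r\<close> that the Vandermonde identity evaluates. For injectivity it suffices to look
  at the sets \<open>Z\<close> with \<open>|Z \<inter> B| = j\<close>: there \<open>T\<^sub>k F\<close> is, up to the factor \<open>e\<^sub>0 \<noteq> 0\<close>, the map \<open>R\<^sub>K\<close> on \<open>A\<close> applied
  to each slice of \<open>F\<close> along a \<open>j\<close>-subset of \<open>B\<close>, and these slices lie in the kernel of \<open>d\<close>.
\<close>

section \<open>Subset sums\<close>

text \<open>
  The zeta transform of the Boolean lattice.
\<close>

definition zeta :: "('a set \<Rightarrow> complex) \<Rightarrow> 'a set \<Rightarrow> complex" where
  "zeta f Z = (\<Sum>C\<in>Pow Z. f C)"

lemma sum_fun_apply: "(\<Sum>x\<in>S. f x) y = (\<Sum>x\<in>S. f x y)"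
  for f :: "'b \<Rightarrow> 'c \<Rightarrow> complex"
  by (induction S rule: infinite_finite_induct) auto

lemma sum_Collect_if:
  assumes "finite {x. P x}"
  shows "(\<Sum>x | P x. if Q x then f x else 0) = (\<Sum>x | P x \<and> Q x. f x)"
  using sum.inter_filter[OF assms, of f Q] by simp

text \<open>
  Double counting of pairs \<open>C \<subseteq> E\<close>. With weights \<open>g\<close> that single out sets of a given size this is the
  adjointness of the raising maps and the lowering maps, and it reduces sums of subset sums to counting intervals.
\<close>

lemma sum_zeta_swap:
  assumes "finite D"
  shows "(\<Sum>E\<in>Pow D. g E * zeta f E) = (\<Sum>C\<in>Pow D. f C * (\<Sum>E | C \<subseteq> E \<and> E \<subseteq> D. g E))"
proof -
  have "(\<Sum>E\<in>Pow D. g E * zeta f E) = (\<Sum>E\<in>Pow D. \<Sum>C\<in>{C \<in> Pow D. C \<subseteq> E}. g E * f C)"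
    unfolding zeta_def sum_distrib_left by (intro sum.cong) auto
  also have "\<dots> = (\<Sum>C\<in>Pow D. \<Sum>E\<in>{E \<in> Pow D. C \<subseteq> E}. g E * f C)"
    using assms by (intro sum.swap_restrict) auto
  also have "\<dots> = (\<Sum>C\<in>Pow D. f C * (\<Sum>E | C \<subseteq> E \<and> E \<subseteq> D. g E))"
    unfolding sum_distrib_left by (intro sum.cong) (auto simp: mult.commute)
  finally show ?thesis .
qed

lemma R_map_apply:
  assumes "finite X"
  shows "R_map X q f D = (if D \<subseteq> X then \<Sum>C | C \<subseteq> D \<and> card D = card C + q. f C else 0)"
proof -
  have fin: "finite {D. C \<subseteq> D \<and> D \<subseteq> X \<and> card D = card C + q}" for C
    by (rule finite_subset[of _ "Pow X"]) (use assms in auto)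
  have "R_map X q f D = (\<Sum>C\<in>Pow X. if C \<subseteq> D \<and> D \<subseteq> X \<and> card D = card C + q then f C else 0)"
    unfolding R_map_def sum_fun_apply fscale_def dirac_def
    by (intro sum.cong) (auto simp: sum.delta fin)
  also have "\<dots> = (\<Sum>C\<in>{C\<in>Pow X. C \<subseteq> D \<and> D \<subseteq> X \<and> card D = card C + q}. f C)"
    by (rule sum.inter_filter[symmetric]) (simp add: assms)
  also have "\<dots> = (if D \<subseteq> X then \<Sum>C | C \<subseteq> D \<and> card D = card C + q. f C else 0)"
    by (auto intro!: sum.cong)
  finally show ?thesis .
qed

text \<open>
  For a function on \<open>p\<close>-sets the size restriction in \<open>R\<^sub>q\<close> is automatic once \<open>D\<close> has \<open>p + q\<close> elements. All later
  work is with \<open>\<zeta> f\<close> in place of the separate maps \<open>R\<^sub>q\<close>.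
\<close>

lemma R_map_perm_mod:
  assumes "finite X" "f \<in> perm_mod X p"
  shows "R_map X q f D = (if D \<subseteq> X \<and> card D = p + q then zeta f D else 0)"
proof (cases "D \<subseteq> X")
  case True
  then have fin: "finite D" using assms(1) finite_subset by blast
  have "(\<Sum>C | C \<subseteq> D \<and> card D = card C + q. f C) = (\<Sum>C\<in>Pow D. if card D = card C + q then f C else 0)"
    using fin by (subst sum.inter_filter[symmetric]) (auto intro!: sum.cong)
  also have "\<dots> = (\<Sum>C\<in>Pow D. if card D = p + q then f C else 0)"
    using assms(2) by (intro sum.cong) (auto simp: perm_mod_def)
  finally show ?thesis using True by (simp add: R_map_apply assms(1) zeta_def)
qed (simp add: R_map_apply assms(1))

text \<open>
  The pairs \<open>(D, x)\<close> with \<open>x \<in> D\<close> and \<open>D - {x} = C\<close> are the one-point extensions of \<open>C\<close>.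
\<close>

lemma d_map_apply:
  assumes "finite X"
  shows "d_map X f C = (if C \<subseteq> X then \<Sum>x\<in>X - C. f (insert x C) else 0)"
proof -
  have "d_map X f C = (\<Sum>D\<in>Pow X. \<Sum>x\<in>D. if C = D - {x} then f D else 0)"
    unfolding d_map_def sum_fun_apply fscale_def dirac_def sum_distrib_left
    by (intro sum.cong) auto
  also have "\<dots> = (\<Sum>(D,x)\<in>Sigma (Pow X) (\<lambda>D. D). if C = D - {x} then f D else 0)"
    using assms by (intro sum.Sigma) (auto intro: finite_subset)
  also have "\<dots> = (\<Sum>(D,x)\<in>{p \<in> Sigma (Pow X) (\<lambda>D. D). C = fst p - {snd p}}. f D)"
    using assms by (subst sum.inter_filter) (auto intro!: finite_SigmaI sum.cong intro: finite_subset)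
  also have "\<dots> = (\<Sum>x\<in>(if C \<subseteq> X then X - C else {}). f (insert x C))"
    by (rule sum.reindex_bij_witness[where i = "\<lambda>x. (insert x C, x)" and j = snd])
      (auto simp: insert_absorb split: if_splits)
  finally show ?thesis by simp
qed

lemma d_map_linear: "linear_map_on UNIV (d_map X)"
  unfolding linear_map_on_def d_map_def
  by (auto simp: fun_eq_iff sum_fun_apply fscale_def sum.distrib sum_distrib_left algebra_simps)

lemma zeta_add: "zeta (f + g) Z = zeta f Z + zeta g Z"
  and zeta_fscale: "zeta (fscale c f) Z = c * zeta f Z"
  by (simp_all add: zeta_def sum.distrib sum_distrib_left fscale_def)

lemma zeta_eq_0_if_small:
  assumes "f \<in> perm_mod X p" "finite Z" "card Z < p"
  shows "zeta f Z = 0"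
  unfolding zeta_def
proof (rule sum.neutral, rule ballI)
  fix C assume "C \<in> Pow Z"
  then have "card C \<le> card Z" using assms(2) by (auto intro: card_mono)
  then show "f C = 0" using assms(1,3) by (auto simp: perm_mod_def)
qed

lemma zeta_same_card:
  assumes "f \<in> perm_mod X p" "finite Z" "card Z = p"
  shows "zeta f Z = f Z"
proof -
  have "(\<Sum>C\<in>Pow Z. f C) = (\<Sum>C\<in>{Z}. f C)"
    by (rule sum.mono_neutral_right)
      (use assms card_subset_eq[of Z] in \<open>auto simp: perm_mod_def\<close>)
  then show ?thesis by (simp add: zeta_def)
qed

lemma zeta_insert:
  assumes "finite Z" "x \<notin> Z"
  shows "zeta f (insert x Z) = zeta f Z + (\<Sum>C\<in>Pow Z. f (insert x C))"
proof -
  have inj: "inj_on (insert x) (Pow Z)"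
    using assms(2) by (auto simp: inj_on_def)
  show ?thesis
    unfolding zeta_def Pow_insert
    by (subst sum.union_disjoint) (use assms in \<open>auto simp: sum.reindex[OF inj]\<close>)
qed

lemma card_subset_interval:
  assumes "finite Z" "C \<subseteq> Z" "card C \<le> p"
  shows "card {Y. C \<subseteq> Y \<and> Y \<subseteq> Z \<and> card Y = p} = (card Z - card C) choose (p - card C)"
proof -
  have fC: "finite C" using assms finite_subset by blast
  have "card {Y. C \<subseteq> Y \<and> Y \<subseteq> Z \<and> card Y = p} = card {W. W \<subseteq> Z - C \<and> card W = p - card C}"
  proof (rule bij_betw_same_card[of "\<lambda>Y. Y - C"], rule bij_betw_byWitness[where f' = "\<lambda>W. W \<union> C"])
    show "(\<lambda>Y. Y - C) ` {Y. C \<subseteq> Y \<and> Y \<subseteq> Z \<and> card Y = p} \<subseteq> {W. W \<subseteq> Z - C \<and> card W = p - card C}"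
      using fC by (auto simp: card_Diff_subset)
    show "(\<lambda>W. W \<union> C) ` {W. W \<subseteq> Z - C \<and> card W = p - card C} \<subseteq> {Y. C \<subseteq> Y \<and> Y \<subseteq> Z \<and> card Y = p}"
    proof safe
      fix W assume W: "W \<subseteq> Z - C" "card W = p - card C"
      then show "card (W \<union> C) = p" using fC assms
        by (subst card_Un_disjoint) (auto intro: finite_subset)
    qed (use assms in auto)
  qed auto
  also have "\<dots> = (card (Z - C)) choose (p - card C)"
    using assms by (intro n_subsets) auto
  finally show ?thesis using assms fC by (simp add: card_Diff_subset)
qed

lemma R_map_in_perm_mod:
  assumes "finite X" "f \<in> perm_mod X p"
  shows "R_map X q f \<in> perm_mod X (p + q)"
  using R_map_perm_mod[OF assms] by (auto simp: perm_mod_def)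

text \<open>
  Between a set and a superset with \<open>p + q\<close> more elements there are \<open>p + q choose p\<close> sets of the intermediate size.
\<close>

lemma R_map_R_map:
  assumes X: "finite X" and f: "f \<in> perm_mod X l"
  shows "R_map X q (R_map X p f) = fscale (of_nat ((p + q) choose q)) (R_map X (p + q) f)"
proof
  fix D
  note g = R_map_in_perm_mod[OF X f, of p]
  show "R_map X q (R_map X p f) D = fscale (of_nat ((p + q) choose q)) (R_map X (p + q) f) D"
  proof (cases "D \<subseteq> X \<and> card D = l + p + q")
    case True
    then have fD: "finite D" using X finite_subset by blast
    let ?h = "\<lambda>E. if card E = l + p then 1 else 0 :: complex"
    have "zeta (R_map X p f) D = (\<Sum>E\<in>Pow D. ?h E * zeta f E)"
      unfolding zeta_def[of "R_map X p f"] using True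
      by (intro sum.cong) (auto simp: R_map_perm_mod[OF X f])
    also have "\<dots> = (\<Sum>C\<in>Pow D. f C * (\<Sum>E | C \<subseteq> E \<and> E \<subseteq> D. ?h E))"
      by (rule sum_zeta_swap[OF fD])
    also have "\<dots> = (\<Sum>C\<in>Pow D. f C * of_nat ((p + q) choose q))"
    proof (intro sum.cong refl)
      fix C assume C: "C \<in> Pow D"
      show "f C * (\<Sum>E | C \<subseteq> E \<and> E \<subseteq> D. ?h E) = f C * of_nat ((p + q) choose q)"
      proof (cases "f C = 0")
        case False
        then have c: "card C = l" using f by (auto simp: perm_mod_def)
        have fin: "finite {E. C \<subseteq> E \<and> E \<subseteq> D}"
          by (rule finite_subset[of _ "Pow D"]) (use fD in auto)
        have "(\<Sum>E | C \<subseteq> E \<and> E \<subseteq> D. ?h E) = of_nat (card {E. C \<subseteq> E \<and> E \<subseteq> D \<and> card E = l + p})"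
          using fin by (simp add: sum.inter_filter[symmetric] conj_assoc)
        also have "\<dots> = of_nat ((p + q) choose p)"
          using C c True fD by (subst card_subset_interval) auto
        finally show ?thesis using binomial_symmetric[of p "p + q"] by simp
      qed simp
    qed
    finally show ?thesis using True
      by (simp add: R_map_perm_mod[OF X g] R_map_perm_mod[OF X f] fscale_def zeta_def
          sum_distrib_left sum_distrib_right mult.commute add.assoc)
  next
    case False
    then show ?thesis
      by (auto simp: R_map_perm_mod[OF X g] R_map_perm_mod[OF X f] fscale_def add.assoc)
  qed
qed

section \<open>Subset sums of functions killed by d\<close>

text \<open>
  Adding a point \<open>x\<close> to \<open>Z\<close> adds to \<open>(\<zeta> \<phi>)(Z)\<close> the values \<open>\<phi>(C \<union> {x})\<close> with \<open>C \<subseteq> Z\<close>. For fixed \<open>C\<close>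
  these values, summed over all \<open>x \<notin> C\<close>, give \<open>(d \<phi>)(C) = 0\<close>. So the sum over \<open>x \<notin> Z\<close> is minus the sum over
  \<open>x \<in> Z - C\<close>, and the latter counts each subset of \<open>Z\<close> once for each of its \<open>i\<close> elements.
\<close>

lemma sum_insert_zeta_specht:
  assumes A: "finite A" and \<phi>: "\<phi> \<in> specht A i" and Z: "Z \<subseteq> A"
  shows "(\<Sum>x\<in>A - Z. zeta \<phi> (insert x Z)) = (of_nat (card A) - of_nat (card Z) - of_nat i) * zeta \<phi> Z"
proof -
  have fZ: "finite Z" using A Z finite_subset by blast
  \<comment> \<open>The equation \<open>(d \<phi>)(C) = 0\<close>, split according to \<open>x \<in> Z\<close>.\<close>
  have d0: "(\<Sum>x\<in>A - Z. \<phi> (insert x C)) = - (\<Sum>x\<in>Z - C. \<phi> (insert x C))" if "C \<subseteq> Z" for C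
  proof -
    have "0 = d_map A \<phi> C" using \<phi> by (simp add: specht_def)
    also have "\<dots> = (\<Sum>x\<in>(A - Z) \<union> (Z - C). \<phi> (insert x C))"
      using that Z by (auto simp: d_map_apply A intro!: sum.cong)
    also have "\<dots> = (\<Sum>x\<in>A - Z. \<phi> (insert x C)) + (\<Sum>x\<in>Z - C. \<phi> (insert x C))"
      using A fZ by (intro sum.union_disjoint) auto
    finally show ?thesis by (simp add: eq_neg_iff_add_eq_0)
  qed
  \<comment> \<open>Substitute \<open>D = C \<union> {x}\<close>, so that \<open>x\<close> runs over the elements of \<open>D\<close>.\<close>
  have "(\<Sum>C\<in>Pow Z. \<Sum>x\<in>Z - C. \<phi> (insert x C)) = (\<Sum>(C,x)\<in>Sigma (Pow Z) (\<lambda>C. Z - C). \<phi> (insert x C))"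
    using fZ by (intro sum.Sigma) auto
  also have "\<dots> = (\<Sum>(D,x)\<in>Sigma (Pow Z) (\<lambda>D. D). \<phi> D)"
    by (rule sum.reindex_bij_witness[where i = "\<lambda>(D,x). (D - {x}, x)" and j = "\<lambda>(C,x). (insert x C, x)"])
      (auto simp: insert_absorb)
  also have "\<dots> = (\<Sum>D\<in>Pow Z. \<Sum>x\<in>D. \<phi> D)"
    using fZ by (intro sum.Sigma[symmetric]) (auto intro: finite_subset)
  also have "\<dots> = of_nat i * zeta \<phi> Z"
    unfolding zeta_def sum_distrib_left
    using \<phi> by (intro sum.cong) (auto simp: specht_def perm_mod_def)
  finally have *: "(\<Sum>C\<in>Pow Z. \<Sum>x\<in>Z - C. \<phi> (insert x C)) = of_nat i * zeta \<phi> Z" .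
  have "(\<Sum>x\<in>A - Z. zeta \<phi> (insert x Z)) = (\<Sum>x\<in>A - Z. zeta \<phi> Z + (\<Sum>C\<in>Pow Z. \<phi> (insert x C)))"
    by (intro sum.cong) (auto simp: zeta_insert fZ)
  also have "\<dots> = of_nat (card (A - Z)) * zeta \<phi> Z + (\<Sum>C\<in>Pow Z. \<Sum>x\<in>A - Z. \<phi> (insert x C))"
    by (simp add: sum.distrib) (rule sum.swap)
  also have "(\<Sum>C\<in>Pow Z. \<Sum>x\<in>A - Z. \<phi> (insert x C)) = - (of_nat i * zeta \<phi> Z)"
    unfolding *[symmetric] sum_negf[symmetric] by (rule sum.cong) (auto simp: d0 sum_negf)
  also have "of_nat (card (A - Z)) = (of_nat (card A) - of_nat (card Z) :: complex)"
    using A Z fZ by (simp add: card_Diff_subset of_nat_diff card_mono)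
  finally show ?thesis by (simp add: algebra_simps)
qed

lemma binomial_Suc_diff:
  "(of_nat N - of_nat q) * of_nat (N choose q) = (of_nat (Suc q) * of_nat (N choose Suc q) :: complex)"
proof (cases "q \<le> N")
  case True
  have "(N - q) * (N choose q) = Suc q * (N choose Suc q)"
    by (simp only: binomial_absorb_comp binomial_absorption)
  then have "of_nat ((N - q) * (N choose q)) = (of_nat (Suc q * (N choose Suc q)) :: complex)"
    by (rule arg_cong)
  then show ?thesis using True by (simp only: of_nat_mult of_nat_diff)
qed (simp add: binomial_eq_0)

text \<open>
  Induction on \<open>q\<close>: counting the pairs of a superset and one of its \<open>q + 1\<close> new points reduces the sum over
  supersets with \<open>q + 1\<close> new points to one-point extensions of the supersets with \<open>q\<close> new points.
\<close>

lemma sum_supersets_zeta_specht: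
  assumes A: "finite A" and \<phi>: "\<phi> \<in> specht A i" and Y: "Y \<subseteq> A" and c: "card Y + i \<le> card A"
  shows "(\<Sum>Z | Y \<subseteq> Z \<and> Z \<subseteq> A \<and> card Z = card Y + q. zeta \<phi> Z)
    = of_nat ((card A - card Y - i) choose q) * zeta \<phi> Y"
proof (induction q)
  case 0
  have "{Z. Y \<subseteq> Z \<and> Z \<subseteq> A \<and> card Z = card Y} = {Y}"
  proof (intro equalityI subsetI)
    fix Z assume "Z \<in> {Z. Y \<subseteq> Z \<and> Z \<subseteq> A \<and> card Z = card Y}"
    then show "Z \<in> {Y}" using card_subset_eq[of Z Y] A by (auto intro: finite_subset)
  qed (use Y in auto)
  then show ?case by simp
next
  case (Suc q)
  define S where "S q = {Z. Y \<subseteq> Z \<and> Z \<subseteq> A \<and> card Z = card Y + q}" for q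
  have fin: "finite (S q)" for q
    unfolding S_def by (rule finite_subset[of _ "Pow A"]) (use A in auto)
  have fZ: "finite Z" if "Z \<in> S q" for Z q
    using that A by (auto simp: S_def intro: finite_subset)
  \<comment> \<open>Each superset with \<open>q + 1\<close> new points arises from \<open>q + 1\<close> supersets with \<open>q\<close> new points.\<close>
  have "of_nat (Suc q) * (\<Sum>Z\<in>S (Suc q). zeta \<phi> Z) = (\<Sum>Z\<in>S (Suc q). \<Sum>x\<in>Z - Y. zeta \<phi> Z)"
    unfolding sum_distrib_left
  proof (intro sum.cong refl)
    fix Z assume Z: "Z \<in> S (Suc q)"
    then have "card (Z - Y) = Suc q" using fZ[OF Z]
      by (auto simp: S_def card_Diff_subset finite_subset)
    then show "of_nat (Suc q) * zeta \<phi> Z = (\<Sum>x\<in>Z - Y. zeta \<phi> Z)"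
      by (simp only: sum_constant)
  qed
  also have "\<dots> = (\<Sum>(Z,x)\<in>Sigma (S (Suc q)) (\<lambda>Z. Z - Y). zeta \<phi> Z)"
    using fin fZ by (intro sum.Sigma) auto
  also have "\<dots> = (\<Sum>(Z,x)\<in>Sigma (S q) (\<lambda>Z. A - Z). zeta \<phi> (insert x Z))"
    by (rule sum.reindex_bij_witness[where i = "\<lambda>(Z,x). (insert x Z, x)" and j = "\<lambda>(Z,x). (Z - {x}, x)"])
      (auto simp: insert_absorb S_def finite_subset[OF _ A])
  also have "\<dots> = (\<Sum>Z\<in>S q. \<Sum>x\<in>A - Z. zeta \<phi> (insert x Z))"
    using fin A by (intro sum.Sigma[symmetric]) auto
  also have "\<dots> = (\<Sum>Z\<in>S q. (of_nat (card A - card Y - i) - of_nat q) * zeta \<phi> Z)"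
    using c by (intro sum.cong refl)
      (auto simp: S_def sum_insert_zeta_specht[OF A \<phi>] of_nat_diff algebra_simps)
  also have "\<dots> = (of_nat (card A - card Y - i) - of_nat q) * (of_nat ((card A - card Y - i) choose q) * zeta \<phi> Y)"
    unfolding sum_distrib_left[symmetric] using Suc by (simp add: S_def)
  also have "\<dots> = of_nat (Suc q) * (of_nat ((card A - card Y - i) choose Suc q) * zeta \<phi> Y)"
    by (simp only: mult.assoc[symmetric] binomial_Suc_diff)
  finally have "(\<Sum>Z\<in>S (Suc q). zeta \<phi> Z) = of_nat ((card A - card Y - i) choose Suc q) * zeta \<phi> Y"
    by (subst (asm) mult_cancel_left) (simp only: of_nat_eq_0_iff, simp)
  then show ?case by (simp add: S_def)
qed

text \<open>
  The norm of \<open>R\<^sub>q \<phi>\<close>: expand one of the two factors and sum the other over all supersets of a fixed \<open>i\<close>-set.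
\<close>

lemma norm_zeta_specht:
  assumes A: "finite A" and \<phi>: "\<phi> \<in> specht A i" and i: "2 * i \<le> card A"
  shows "(\<Sum>Z | Z \<subseteq> A \<and> card Z = i + q. zeta \<phi> Z * cnj (zeta \<phi> Z))
    = of_nat ((card A - 2 * i) choose q) * M_inner A i \<phi> \<phi>"
proof -
  let ?g = "\<lambda>Z. if card Z = i + q then zeta \<phi> Z else 0"
  let ?N = "of_nat ((card A - 2 * i) choose q) :: complex"
  have cz: "cnj (zeta \<phi> Z) = zeta (\<lambda>C. cnj (\<phi> C)) Z" for Z
    by (simp add: zeta_def)
  have "(\<Sum>Z | Z \<subseteq> A \<and> card Z = i + q. zeta \<phi> Z * cnj (zeta \<phi> Z))
    = (\<Sum>Z\<in>{Z\<in>Pow A. card Z = i + q}. zeta \<phi> Z * cnj (zeta \<phi> Z))"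
    by (intro sum.cong) auto
  also have "\<dots> = (\<Sum>Z\<in>Pow A. ?g Z * zeta (\<lambda>C. cnj (\<phi> C)) Z)"
    using A by (subst sum.inter_filter) (auto intro!: sum.cong simp: cz)
  also have "\<dots> = (\<Sum>C\<in>Pow A. cnj (\<phi> C) * (\<Sum>Z | C \<subseteq> Z \<and> Z \<subseteq> A. ?g Z))"
    by (rule sum_zeta_swap[OF A])
  also have "\<dots> = (\<Sum>C\<in>Pow A. if card C = i then ?N * (\<phi> C * cnj (\<phi> C)) else 0)"
  proof (intro sum.cong refl)
    fix C assume C: "C \<in> Pow A"
    show "cnj (\<phi> C) * (\<Sum>Z | C \<subseteq> Z \<and> Z \<subseteq> A. ?g Z) = (if card C = i then ?N * (\<phi> C * cnj (\<phi> C)) else 0)"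
    proof (cases "card C = i")
      case True
      have fin: "finite {Z. C \<subseteq> Z \<and> Z \<subseteq> A}"
        by (rule finite_subset[of _ "Pow A"]) (use A in auto)
      have "(\<Sum>Z | C \<subseteq> Z \<and> Z \<subseteq> A. ?g Z) = (\<Sum>Z | C \<subseteq> Z \<and> Z \<subseteq> A \<and> card Z = card C + q. zeta \<phi> Z)"
        using True fin by (subst sum.inter_filter[symmetric]) (auto intro!: sum.cong)
      also have "\<dots> = ?N * zeta \<phi> C"
        using C True i by (subst sum_supersets_zeta_specht[OF A \<phi>]) (auto simp: mult_2)
      also have "zeta \<phi> C = \<phi> C"
        using \<phi> True C A by (intro zeta_same_card) (auto simp: specht_def finite_subset)
      finally show ?thesis using True by simp
    next
      case False
      then have "\<phi> C = 0" using \<phi> by (auto simp: specht_def perm_mod_def)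
      then show ?thesis using False by simp
    qed
  qed
  also have "\<dots> = (\<Sum>C\<in>{C\<in>Pow A. card C = i}. ?N * (\<phi> C * cnj (\<phi> C)))"
    by (rule sum.inter_filter[symmetric]) (simp add: A)
  also have "\<dots> = ?N * M_inner A i \<phi> \<phi>"
    unfolding M_inner_def sum_distrib_left by (intro sum.cong) auto
  finally show ?thesis .
qed

lemma norm_R_map_specht:
  assumes X: "finite X" and f: "f \<in> specht X p" and p: "2 * p \<le> card X"
  shows "M_inner X (p + q) (R_map X q f) (R_map X q f) = of_nat ((card X - 2 * p) choose q) * M_inner X p f f"
proof -
  have f': "f \<in> perm_mod X p" using f by (simp add: specht_def)
  have "M_inner X (p + q) (R_map X q f) (R_map X q f)
    = (\<Sum>Z | Z \<subseteq> X \<and> card Z = p + q. zeta f Z * cnj (zeta f Z))"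
    unfolding M_inner_def by (rule sum.cong) (auto simp: R_map_perm_mod[OF X f'])
  then show ?thesis by (simp only: norm_zeta_specht[OF X f p])
qed

text \<open>
  For such \<open>Z\<close> the binomial coefficient in the norm formula is \<open>0\<close>, so the whole of \<open>R\<^sub>q \<phi>\<close> vanishes.
\<close>

lemma zeta_specht_eq_0_if_large:
  assumes A: "finite A" and \<phi>: "\<phi> \<in> specht A i" and i: "2 * i \<le> card A"
    and Z: "Z \<subseteq> A" "card A < card Z + i"
  shows "zeta \<phi> Z = 0"
proof -
  define q where "q = card Z - i"
  have q: "card Z = i + q" "card A - 2 * i < q" using i Z(2) by (auto simp: q_def)
  let ?S = "{Z. Z \<subseteq> A \<and> card Z = i + q}"
  have fin: "finite ?S" by (rule finite_subset[of _ "Pow A"]) (use A in auto)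
  have "complex_of_real (\<Sum>Z\<in>?S. (cmod (zeta \<phi> Z))\<^sup>2) = (\<Sum>Z\<in>?S. zeta \<phi> Z * cnj (zeta \<phi> Z))"
    by (simp only: of_real_sum complex_norm_square)
  also have "\<dots> = 0"
    using norm_zeta_specht[OF A \<phi> i, of q] q(2) by (simp add: binomial_eq_0)
  finally have "(\<Sum>Z\<in>?S. (cmod (zeta \<phi> Z))\<^sup>2) = 0" by (simp only: of_real_eq_0_iff)
  then have "\<forall>Z\<in>?S. (cmod (zeta \<phi> Z))\<^sup>2 = 0"
    using fin by (subst (asm) sum_nonneg_eq_0_iff) auto
  then show ?thesis using Z(1) q(1) by auto
qed

text \<open>
  Injectivity of \<open>R\<^sub>q\<close> on the kernel of \<open>d\<close>, in the range where the binomial coefficient in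
  \<open>sum_supersets_zeta_specht\<close> is not \<open>0\<close>.
\<close>

lemma specht_eq_0_if_zeta_eq_0:
  assumes A: "finite A" and \<phi>: "\<phi> \<in> specht A i" and q: "2 * i + q \<le> card A"
    and z: "\<And>Z. Z \<subseteq> A \<Longrightarrow> card Z = i + q \<Longrightarrow> zeta \<phi> Z = 0"
  shows "\<phi> = 0"
proof
  fix C
  show "\<phi> C = 0 C"
  proof (cases "C \<subseteq> A \<and> card C = i")
    case True
    have "0 = (\<Sum>Z | C \<subseteq> Z \<and> Z \<subseteq> A \<and> card Z = card C + q. zeta \<phi> Z)"
      using True z by (intro sum.neutral[symmetric]) auto
    also have "\<dots> = of_nat ((card A - 2 * i) choose q) * zeta \<phi> C"
      using True q by (subst sum_supersets_zeta_specht[OF A \<phi>]) (auto simp: mult_2)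
    also have "zeta \<phi> C = \<phi> C"
      using \<phi> True A by (intro zeta_same_card) (auto simp: specht_def finite_subset)
    finally show ?thesis using q by (auto simp: binomial_eq_0_iff)
  next
    case False
    then show ?thesis using \<phi> by (auto simp: specht_def perm_mod_def)
  qed
qed

section \<open>Functions on subsets of a disjoint union\<close>

lemma sum_Pow_union:
  fixes f g :: "'a set \<Rightarrow> complex"
  assumes "finite Z" "A \<inter> B = {}" "Z \<subseteq> A \<union> B"
  shows "(\<Sum>Y\<in>Pow Z. f (Y \<inter> A) * g (Y \<inter> B)) = (\<Sum>Y\<in>Pow (Z \<inter> A). f Y) * (\<Sum>Y\<in>Pow (Z \<inter> B). g Y)"
proof -
  have "(\<Sum>Y\<in>Pow Z. f (Y \<inter> A) * g (Y \<inter> B)) = (\<Sum>(Y1, Y2)\<in>Pow (Z \<inter> A) \<times> Pow (Z \<inter> B). f Y1 * g Y2)"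
  proof (rule sum.reindex_bij_witness[where i = "\<lambda>(Y1,Y2). Y1 \<union> Y2" and j = "\<lambda>Y. (Y \<inter> A, Y \<inter> B)"])
    fix p assume p: "p \<in> Pow (Z \<inter> A) \<times> Pow (Z \<inter> B)"
    then obtain Y1 Y2 where "p = (Y1, Y2)" "Y1 \<subseteq> A" "Y2 \<subseteq> B" by auto
    moreover from this have "(Y1 \<union> Y2) \<inter> A = Y1" "(Y1 \<union> Y2) \<inter> B = Y2"
      using assms(2) by auto
    ultimately show "((case p of (Y1, Y2) \<Rightarrow> Y1 \<union> Y2) \<inter> A, (case p of (Y1, Y2) \<Rightarrow> Y1 \<union> Y2) \<inter> B) = p"
      by simp
  qed (use assms(3) in auto)
  then show ?thesis by (simp add: sum_product sum.cartesian_product)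
qed

lemma card_union_split:
  assumes "finite Z" "A \<inter> B = {}" "Z \<subseteq> A \<union> B"
  shows "card Z = card (Z \<inter> A) + card (Z \<inter> B)"
proof -
  have "card Z = card ((Z \<inter> A) \<union> (Z \<inter> B))"
    using assms(3) by (intro arg_cong[where f = card]) auto
  also have "\<dots> = card (Z \<inter> A) + card (Z \<inter> B)"
    using assms by (intro card_Un_disjoint) auto
  finally show ?thesis .
qed

text \<open>
  Sorting the \<open>k\<close>-subsets by their number \<open>w\<close> of elements in \<open>B\<close> turns the sum of a product into a convolution. It
  is used both for counting interval sets and for the norm of \<open>T\<^sub>k\<close>.
\<close>

lemma sum_card_subsets_union:
  fixes f g :: "'a set \<Rightarrow> complex"
  assumes fin: "finite A" "finite B" and AB: "A \<inter> B = {}"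
  shows "(\<Sum>Z | Z \<subseteq> A \<union> B \<and> card Z = k. f (Z \<inter> A) * g (Z \<inter> B))
    = (\<Sum>w\<le>k. (\<Sum>Y | Y \<subseteq> A \<and> card Y = k - w. f Y) * (\<Sum>Y | Y \<subseteq> B \<and> card Y = w. g Y))"
proof -
  let ?S = "{Z. Z \<subseteq> A \<union> B \<and> card Z = k}"
  have fS: "finite ?S" by (rule finite_subset[of _ "Pow (A \<union> B)"]) (use fin in auto)
  have fZ: "finite Z" if "Z \<in> ?S" for Z using that fin finite_subset[of Z "A \<union> B"] by auto
  have "(\<Sum>Z\<in>?S. f (Z \<inter> A) * g (Z \<inter> B))
    = (\<Sum>w\<le>k. \<Sum>Z\<in>{Z\<in>?S. card (Z \<inter> B) = w}. f (Z \<inter> A) * g (Z \<inter> B))"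
  proof (rule sum.group[symmetric, OF fS])
    have *: "card (Z \<inter> B) \<le> k" if Z: "Z \<in> ?S" for Z
    proof -
      have "card (Z \<inter> B) \<le> card Z" by (rule card_mono[OF fZ[OF Z]]) (rule Int_lower1)
      also have "card Z = k" using Z by (rule CollectE) (erule conjunct2)
      finally show ?thesis .
    qed
    show "(\<lambda>Z. card (Z \<inter> B)) ` ?S \<subseteq> {..k}" using * by (intro image_subsetI) (rule atMost_iff[THEN iffD2])
    show "finite {..k}" by (rule finite_atMost)
  qed
  also have "\<dots> = (\<Sum>w\<le>k. \<Sum>(Y1, Y2)\<in>{Y. Y \<subseteq> A \<and> card Y = k - w} \<times> {Y. Y \<subseteq> B \<and> card Y = w}. f Y1 * g Y2)"
  proof (rule sum.cong[OF refl])
    fix w assume w: "w \<in> {..k}"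
    show "(\<Sum>Z\<in>{Z\<in>?S. card (Z \<inter> B) = w}. f (Z \<inter> A) * g (Z \<inter> B))
      = (\<Sum>(Y1, Y2)\<in>{Y. Y \<subseteq> A \<and> card Y = k - w} \<times> {Y. Y \<subseteq> B \<and> card Y = w}. f Y1 * g Y2)"
    proof (rule sum.reindex_bij_witness[where i = "\<lambda>(Y1,Y2). Y1 \<union> Y2" and j = "\<lambda>Y. (Y \<inter> A, Y \<inter> B)"])
      fix Z assume Z: "Z \<in> {Z\<in>?S. card (Z \<inter> B) = w}"
      then have "card Z = card (Z \<inter> A) + card (Z \<inter> B)"
        by (intro card_union_split[OF _ AB] fZ) auto
      then show "(Z \<inter> A, Z \<inter> B) \<in> {Y. Y \<subseteq> A \<and> card Y = k - w} \<times> {Y. Y \<subseteq> B \<and> card Y = w}"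
        using Z by auto
    next
      fix p assume p: "p \<in> {Y. Y \<subseteq> A \<and> card Y = k - w} \<times> {Y. Y \<subseteq> B \<and> card Y = w}"
      then obtain Y1 Y2 where Y: "p = (Y1, Y2)" "Y1 \<subseteq> A" "Y2 \<subseteq> B" "card Y1 = k - w" "card Y2 = w" by auto
      then have 1: "(Y1 \<union> Y2) \<inter> A = Y1" "(Y1 \<union> Y2) \<inter> B = Y2"
        using AB by auto
      show "((case p of (Y1, Y2) \<Rightarrow> Y1 \<union> Y2) \<inter> A, (case p of (Y1, Y2) \<Rightarrow> Y1 \<union> Y2) \<inter> B) = p"
        using 1 Y(1) by simp
      have "card (Y1 \<union> Y2) = card Y1 + card Y2"
        using Y AB fin by (intro card_Un_disjoint) (auto intro: finite_subset)
      then show "(case p of (Y1, Y2) \<Rightarrow> Y1 \<union> Y2) \<in> {Z\<in>?S. card (Z \<inter> B) = w}"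
        using Y w 1 by auto
    next
      fix Z assume "Z \<in> {Z\<in>?S. card (Z \<inter> B) = w}"
      then have "(Z \<inter> A) \<union> (Z \<inter> B) = Z" by blast
      then show "(case (Z \<inter> A, Z \<inter> B) of (Y1, Y2) \<Rightarrow> Y1 \<union> Y2) = Z" by simp
    next
      fix Z show "(case (Z \<inter> A, Z \<inter> B) of (Y1, Y2) \<Rightarrow> f Y1 * g Y2) = f (Z \<inter> A) * g (Z \<inter> B)" by simp
    qed
  qed
  finally show ?thesis by (simp add: sum_product sum.cartesian_product)
qed

text \<open>
  The permutation module of \<open>Sym(A) \<times> Sym(B)\<close> on pairs of an \<open>i\<close>-subset of \<open>A\<close> and a \<open>j\<close>-subset of \<open>B\<close>, such
  a pair being encoded as its union. It contains \<open>S\<^sup>h\<^sup>-\<^sup>i\<^sup>,\<^sup>i(A) \<otimes> S\<^sup>n\<^sup>-\<^sup>h\<^sup>-\<^sup>j\<^sup>,\<^sup>j(B)\<close>.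
\<close>

definition bi_mod :: "'a set \<Rightarrow> nat \<Rightarrow> 'a set \<Rightarrow> nat \<Rightarrow> ('a set \<Rightarrow> complex) set" where
  "bi_mod A i B j = {F. \<forall>Z. F Z \<noteq> 0 \<longrightarrow> Z \<subseteq> A \<union> B \<and> card (Z \<inter> A) = i \<and> card (Z \<inter> B) = j}"

lemma subspace_bi_mod: "fun_vs.subspace (bi_mod A i B j)"
proof -
  have "F Z \<noteq> 0 \<or> G Z \<noteq> 0" if "F Z + G Z \<noteq> 0" for F G :: "'a set \<Rightarrow> complex" and Z
    using that by auto
  then show ?thesis
    unfolding fun_vs.subspace_def bi_mod_def fscale_def by simp blast
qed

lemma tensor_in_bi_mod:
  assumes "finite A" "finite B" "A \<inter> B = {}"
  shows "tensor A i B j \<phi> \<psi> \<in> bi_mod A i B j"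
proof -
  have "card Z = card (Z \<inter> A) + card (Z \<inter> B)" if "Z \<subseteq> A \<union> B" for Z
    using that assms by (intro card_union_split) (auto intro: finite_subset)
  then show ?thesis by (auto simp: bi_mod_def tensor_def)
qed

lemma specht_tensor_subset_bi_mod:
  assumes "finite A" "finite B" "A \<inter> B = {}"
  shows "specht_tensor A i B j \<subseteq> bi_mod A i B j"
  unfolding specht_tensor_def
  by (rule fun_vs.span_minimal) (use tensor_in_bi_mod[OF assms] subspace_bi_mod in auto)

lemma tensor_apply:
  assumes "finite A" "finite B" "A \<inter> B = {}" "\<phi> \<in> perm_mod A i" "\<psi> \<in> perm_mod B j" "Z \<subseteq> A \<union> B"
  shows "tensor A i B j \<phi> \<psi> Z = \<phi> (Z \<inter> A) * \<psi> (Z \<inter> B)"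
proof -
  have "card Z = card (Z \<inter> A) + card (Z \<inter> B)"
    using assms by (intro card_union_split) (auto intro: finite_subset)
  then show ?thesis using assms by (auto simp: tensor_def perm_mod_def)
qed

lemma zeta_tensor:
  assumes "finite A" "finite B" "A \<inter> B = {}" "\<phi> \<in> perm_mod A i" "\<psi> \<in> perm_mod B j" "Z \<subseteq> A \<union> B"
  shows "zeta (tensor A i B j \<phi> \<psi>) Z = zeta \<phi> (Z \<inter> A) * zeta \<psi> (Z \<inter> B)"
proof -
  have "finite Z" using assms by (auto intro: finite_subset)
  have "zeta (tensor A i B j \<phi> \<psi>) Z = (\<Sum>Y\<in>Pow Z. \<phi> (Y \<inter> A) * \<psi> (Y \<inter> B))"
    unfolding zeta_def using assms by (intro sum.cong) (auto simp: tensor_apply)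
  also have "\<dots> = zeta \<phi> (Z \<inter> A) * zeta \<psi> (Z \<inter> B)"
    unfolding zeta_def by (rule sum_Pow_union) fact+
  finally show ?thesis .
qed

section \<open>Hahn polynomials\<close>

text \<open>
  The value \<open>e\<^sub>r\<close> of the Hahn polynomial of degree \<open>K\<close> at \<open>c = K\<close> and \<open>x = r\<close>, where its defining sum has a
  single term (see \<open>hahn_lead\<close> below).
\<close>

definition lead_hahn :: "nat \<Rightarrow> nat \<Rightarrow> nat \<Rightarrow> nat \<Rightarrow> int" where
  "lead_hahn K a b r = (-1) ^ (K - r) * fact K * pochhammer (int b - int K + 1) r * pochhammer (int a - int K + 1) (K - r)"

lemma pochhammer_minus_int: "pochhammer (- int x) r = (-1) ^ r * fact r * int (x choose r)"
proof -
  have "real_of_int (pochhammer (- int x) r) = pochhammer (- real x) r"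
    by (simp add: pochhammer_of_int[symmetric])
  also have "\<dots> = (-1) ^ r * fact r * real (x choose r)"
    unfolding binomial_gbinomial gbinomial_pochhammer by simp
  finally have "real_of_int (pochhammer (- int x) r) = real_of_int ((-1) ^ r * fact r * int (x choose r))"
    by simp
  then show ?thesis by (simp only: of_int_eq_iff)
qed

text \<open>
  The rising factorials of \<open>-x\<close> and of \<open>x - c\<close> are binomial coefficients up to sign and factorials, and the
  factorials combine with \<open>K choose r\<close> to \<open>fact K\<close>. The binomial coefficients vanish outside the original range of
  summation.
\<close>

lemma hahn_eq_sum_lead_hahn:
  assumes "x \<le> c"
  shows "hahn K a b c x = (\<Sum>r\<le>K. lead_hahn K a b r * int (x choose r) * int ((c - x) choose (K - r)))"
proof -
  let ?t = "\<lambda>r. (- 1) ^ r * int (K choose r) * pochhammer (int b - int K + 1) r * pochhammer (- int x) r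
        * pochhammer (int a - int K + 1) (K - r) * pochhammer (int x - int c) (K - r)"
  have t: "?t r = lead_hahn K a b r * int (x choose r) * int ((c - x) choose (K - r))" if "r \<le> K" for r
  proof -
    have xc: "int x - int c = - int (c - x)" using assms by simp
    \<comment> \<open>The sign of the definition cancels the sign in the rising factorial of \<open>-x\<close>.\<close>
    have sq: "(-1) ^ r * (-1) ^ r = (1::int)" by (simp add: power_add[symmetric] mult_2[symmetric])
    have "(fact K :: int) = fact r * fact (K - r) * int (K choose r)"
      using binomial_fact_lemma[OF that] by (metis of_nat_fact of_nat_mult)
    moreover have "?t r = ((-1) ^ r * (-1) ^ r) * (-1) ^ (K - r) * (fact r * fact (K - r) * int (K choose r))
       * pochhammer (int b - int K + 1) r * pochhammer (int a - int K + 1) (K - r) * int (x choose r) * int ((c - x) choose (K - r))"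
      unfolding xc pochhammer_minus_int by (simp add: mult_ac)
    ultimately show ?thesis unfolding sq lead_hahn_def by (simp add: mult_ac)
  qed
  have "hahn K a b c x = (\<Sum>r = x + K - c..min K x. lead_hahn K a b r * int (x choose r) * int ((c - x) choose (K - r)))"
    unfolding hahn_def by (intro sum.cong refl t) auto
  also have "\<dots> = (\<Sum>r\<le>K. lead_hahn K a b r * int (x choose r) * int ((c - x) choose (K - r)))"
  proof (rule sum.mono_neutral_left)
    show "\<forall>r\<in>{..K} - {x + K - c..min K x}.
      lead_hahn K a b r * int (x choose r) * int ((c - x) choose (K - r)) = 0"
    proof
      fix r assume "r \<in> {..K} - {x + K - c..min K x}"
      then have "x < r \<or> c - x < K - r" using assms by auto
      then show "lead_hahn K a b r * int (x choose r) * int ((c - x) choose (K - r)) = 0"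
        by (auto simp: binomial_eq_0)
    qed
  qed auto
  finally show ?thesis .
qed

lemma hahn_lead:
  assumes "r \<le> K"
  shows "hahn K a b K r = lead_hahn K a b r"
proof -
  have "hahn K a b K r = (\<Sum>s\<le>K. lead_hahn K a b s * int (r choose s) * int ((K - r) choose (K - s)))"
    by (rule hahn_eq_sum_lead_hahn[OF assms])
  also have "\<dots> = (\<Sum>s\<in>{r}. lead_hahn K a b s * int (r choose s) * int ((K - r) choose (K - s)))"
  proof (rule sum.mono_neutral_right)
    show "\<forall>s\<in>{..K} - {r}. lead_hahn K a b s * int (r choose s) * int ((K - r) choose (K - s)) = 0"
    proof
      fix s assume "s \<in> {..K} - {r}"
      then have "r < s \<or> K - r < K - s" using assms by auto
      then show "lead_hahn K a b s * int (r choose s) * int ((K - r) choose (K - s)) = 0"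
        by (auto simp: binomial_eq_0)
    qed
  qed (use assms in auto)
  finally show ?thesis by simp
qed

text \<open>
  This two-term relation is what puts the image of \<open>T\<^sub>k\<close> into the kernel of \<open>d\<close>.
\<close>

lemma lead_hahn_rec:
  assumes "r < K"
  shows "lead_hahn K a b r * (int b - int K + int r + 1) + lead_hahn K a b (Suc r) * (int a - int r) = 0"
proof -
  obtain s where s: "K - r = Suc s" "K - Suc r = s" using assms by (metis Suc_diff_Suc)
  have eq: "int a - int K + 1 + int s = int a - int r" using s assms by linarith
  show ?thesis unfolding lead_hahn_def s pochhammer_Suc eq
    by (simp add: algebra_simps)
qed

lemma lead_hahn_nonzero:
  assumes "K \<le> a" "K \<le> b"
  shows "lead_hahn K a b r \<noteq> 0"
  using assms pochhammer_pos[of "int b - int K + 1" r] pochhammer_pos[of "int a - int K + 1" "K - r"]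
  by (simp add: lead_hahn_def)



lemma pochhammer_fact_quotient: "pochhammer (real s + 1) K = fact (s + K) / fact s"
proof (induction K)
  case (Suc K)
  have "fact (s + Suc K) = (real s + 1 + real K) * fact (s + K)" by simp
  then show ?case by (simp only: pochhammer_Suc Suc) simp
qed simp

text \<open>
  The left side is the constant that the computation produces, namely the factor of \<open>R\<^sub>m\<^sub>-\<^sub>k\<close> times those factors in
  \<open>sum_lead_hahn_square\<close> that depend on \<open>a\<close> and \<open>b\<close> through \<open>N = a + b\<close> at most. With \<open>c = s + K\<close> and \<open>N = s + t + 2 K\<close> both sides are quotients of
  factorials.
\<close>

lemma hahn_norm_quotient:
  assumes "K \<le> c" "K + c \<le> N"
  shows "real ((N - 2 * K) choose (c - K)) * fact K * pochhammer (real N - 2 * real K + 2) K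
    = real (N choose c) * inverse (real (N choose K)) * ((real N - real K + 1) / (real N - 2 * real K + 1))
      * pochhammer (real c - real K + 1) K * pochhammer (real N - real c - real K + 1) K"
proof -
  obtain s where s: "c = s + K" using assms(1) by (metis le_add_diff_inverse2)
  obtain t where t: "N = s + t + 2 * K" using assms(2) s by (metis le_add_diff_inverse add.assoc add.commute mult_2)
  \<comment> \<open>Every argument of \<open>pochhammer\<close> has the form \<open>real u + 1\<close> now, so all rising factorials are quotients of factorials.\<close>
  have e: "N - 2 * K = s + t" "c - K = s" "real N - 2 * real K + 2 = real (s + t + 1) + 1"
    "real c - real K + 1 = real s + 1" "real N - real c - real K + 1 = real t + 1"
    "real N - 2 * real K + 1 = real (s + t + 1)" "real N - real K + 1 = real (s + t + K + 1)"
    using s t by simp_all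
  have b: "real ((s + t) choose s) = fact (s + t) / (fact s * fact t)"
    "real (N choose c) = fact (s + t + 2 * K) / (fact (s + K) * fact (t + K))"
    "real (N choose K) = fact (s + t + 2 * K) / (fact K * fact (s + t + K))"
    by (simp_all add: binomial_fact s t add.commute add.left_commute mult_2)
  have f: "fact (s + t + 1) = (real (s + t + 1) * fact (s + t) :: real)"
    "fact (s + t + 1 + K) = (real (s + t + K + 1) * fact (s + t + K) :: real)"
    by (simp_all add: algebra_simps)
  show ?thesis
    unfolding e b pochhammer_fact_quotient f
    by (simp add: divide_simps)
qed

lemma choose_fact_pochhammer: "real (n choose r) * fact r = pochhammer (real n - real r + 1) r"
  by (simp add: binomial_gbinomial gbinomial_pochhammer')

text \<open>
  In each term one of the two copies of the rising factorials in the square of \<open>e\<^sub>r\<close> is absorbed by a binomial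
  coefficient and becomes a factor independent of \<open>r\<close>. What remains is the Vandermonde convolution of rising
  factorials.
\<close>

lemma sum_lead_hahn_square:
  "(\<Sum>r\<le>K. (real_of_int (lead_hahn K a b r))\<^sup>2 * real (b choose (K - r)) * real (a choose r))
    = fact K * pochhammer (real a - real K + 1) K * pochhammer (real b - real K + 1) K
      * pochhammer (real a + real b - 2 * real K + 2) K"
proof -
  let ?PA = "pochhammer (real a - real K + 1)" and ?PB = "pochhammer (real b - real K + 1)"
  have "(real_of_int (lead_hahn K a b r))\<^sup>2 * real (b choose (K - r)) * real (a choose r)
    = fact K * ?PA K * ?PB K * (real (K choose r) * ?PB r * ?PA (K - r))" if r: "r \<le> K" for r
  proof -
    have lead: "(real_of_int (lead_hahn K a b r))\<^sup>2 = (fact K)\<^sup>2 * (?PB r)\<^sup>2 * (?PA (K - r))\<^sup>2"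
      by (simp add: lead_hahn_def power_mult_distrib pochhammer_of_int[symmetric] power_mult[symmetric] mult.commute[of _ 2])
    \<comment> \<open>The two absorptions described above; they complete the rising factorials to length \<open>K\<close>.\<close>
    have B: "?PB K = ?PB r * (real (b choose (K - r)) * fact (K - r))"
      unfolding choose_fact_pochhammer pochhammer_product[OF r] using r by (simp add: of_nat_diff algebra_simps)
    have A: "?PA K = ?PA (K - r) * (real (a choose r) * fact r)"
      unfolding choose_fact_pochhammer pochhammer_product[OF diff_le_self[of K r]] using r by (simp add: of_nat_diff algebra_simps)
    have F: "(fact K :: real) = fact r * fact (K - r) * real (K choose r)"
      using binomial_fact_lemma[OF r] by (metis of_nat_fact of_nat_mult)
    have "(real_of_int (lead_hahn K a b r))\<^sup>2 * real (b choose (K - r)) * real (a choose r)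
       = fact K * (fact r * fact (K - r) * real (K choose r)) * (?PB r)\<^sup>2 * (?PA (K - r))\<^sup>2 * real (b choose (K - r)) * real (a choose r)"
      unfolding lead F[symmetric] by (simp add: power2_eq_square)
    then show ?thesis unfolding A B by (simp add: power2_eq_square mult_ac)
  qed
  then have "(\<Sum>r\<le>K. (real_of_int (lead_hahn K a b r))\<^sup>2 * real (b choose (K - r)) * real (a choose r))
    = fact K * ?PA K * ?PB K * (\<Sum>r\<le>K. real (K choose r) * ?PB r * ?PA (K - r))"
    unfolding sum_distrib_left by (intro sum.cong) auto
  also have "(\<Sum>r\<le>K. real (K choose r) * ?PB r * ?PA (K - r))
    = pochhammer (real a + real b - 2 * real K + 2) K"
    unfolding pochhammer_binomial_sum[symmetric] by (rule arg_cong2[where f = pochhammer]) auto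
  finally show ?thesis .
qed

section \<open>The intertwining operators\<close>

text \<open>
  The operator \<open>T\<^sub>m\<close>, written as a multiple of the subset sum and hence defined on all functions. On sets with
  \<open>|Z \<inter> B| < j\<close> the truncated difference is harmless because \<open>\<zeta> F\<close> vanishes there for \<open>F\<close> in \<open>bi_mod A i B j\<close>.
\<close>

definition intertwiner :: "'a set \<Rightarrow> nat \<Rightarrow> 'a set \<Rightarrow> nat \<Rightarrow> nat \<Rightarrow> nat \<Rightarrow> ('a set \<Rightarrow> complex) \<Rightarrow> ('a set \<Rightarrow> complex)" where
  "intertwiner A i B j k m F = (\<lambda>Z. if Z \<subseteq> A \<union> B \<and> card Z = m
     then of_int (hahn (k - i - j) (card B - 2 * j) (card A - 2 * i) (m - i - j) (card (Z \<inter> B) - j)) * zeta F Z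
     else 0)"

lemma intertwiner_linear: "linear_map_on UNIV (intertwiner A i B j k m)"
  unfolding linear_map_on_def intertwiner_def
  by (auto simp: fun_eq_iff zeta_add zeta_fscale distrib_left fscale_def[of _ "\<lambda>Z. if _ Z then _ Z else _ Z"])

lemma intertwiner_in_perm_mod: "intertwiner A i B j k m F \<in> perm_mod (A \<union> B) m"
  by (auto simp: perm_mod_def intertwiner_def)

text \<open>
  Given \<open>C\<close> of type \<open>(i, j)\<close>, a set \<open>Y\<close> between \<open>C\<close> and \<open>Z\<close> arises by choosing its \<open>r\<close> new points in \<open>B\<close> and its
  remaining \<open>k - i - j - r\<close> new points in \<open>A\<close>.
\<close>

lemma sum_interval_union:
  assumes fZ: "finite Z" and AB: "A \<inter> B = {}" and Z: "Z \<subseteq> A \<union> B" and C: "C \<subseteq> Z"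
    and ij: "card (C \<inter> A) = i" "card (C \<inter> B) = j" "i + j \<le> k"
  shows "(\<Sum>Y | C \<subseteq> Y \<and> Y \<subseteq> Z \<and> card Y = k. g (card (Y \<inter> B) - j) :: complex)
    = (\<Sum>r\<le>k - i - j. g r * of_nat ((card (Z \<inter> B) - j) choose r) * of_nat ((card (Z \<inter> A) - i) choose (k - i - j - r)))"
proof -
  let ?f = "\<lambda>Y. if C \<inter> A \<subseteq> Y then 1 else 0 :: complex"
  let ?g = "\<lambda>Y. if C \<inter> B \<subseteq> Y then g (card Y - j) else 0 :: complex"
  have fZAB: "finite (Z \<inter> A)" "finite (Z \<inter> B)" "(Z \<inter> A) \<inter> (Z \<inter> B) = {}" "(Z \<inter> A) \<union> (Z \<inter> B) = Z"
    using fZ AB Z by auto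
  have fin: "finite {Y. Y \<subseteq> W \<and> card Y = p}" if "finite W" for W :: "'a set" and p
    by (rule finite_subset[of _ "Pow W"]) (use that in auto)
  have F: "(\<Sum>Y | Y \<subseteq> Z \<inter> A \<and> card Y = p. ?f Y) = (if i \<le> p then 1 * of_nat ((card (Z \<inter> A) - i) choose (p - i)) else 0)" for p
  proof -
    have "(\<Sum>Y | Y \<subseteq> Z \<inter> A \<and> card Y = p. ?f Y) = (\<Sum>Y | (Y \<subseteq> Z \<inter> A \<and> card Y = p) \<and> C \<inter> A \<subseteq> Y. 1)"
      by (rule sum_Collect_if[OF fin[OF fZAB(1)]])
    also have "\<dots> = (\<Sum>Y | C \<inter> A \<subseteq> Y \<and> Y \<subseteq> Z \<inter> A \<and> card Y = p. 1)"
      by (rule sum.cong) auto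
    finally have 1: "(\<Sum>Y | Y \<subseteq> Z \<inter> A \<and> card Y = p. ?f Y)
      = 1 * of_nat (card {Y. C \<inter> A \<subseteq> Y \<and> Y \<subseteq> Z \<inter> A \<and> card Y = p})"
      by (simp only: sum_constant mult.commute mult_1_left mult_1_right)
    show ?thesis
    proof (cases "i \<le> p")
      case True
      have CX: "C \<inter> A \<subseteq> Z \<inter> A" using C by blast
      have "card {Y. C \<inter> A \<subseteq> Y \<and> Y \<subseteq> Z \<inter> A \<and> card Y = p} = (card (Z \<inter> A) - i) choose (p - i)"
        using card_subset_interval[OF fZAB(1) CX, of p] True ij(1) by simp
      then show ?thesis unfolding 1 using True by simp
    next
      case False
      have "{Y. C \<inter> A \<subseteq> Y \<and> Y \<subseteq> Z \<inter> A \<and> card Y = p} = {}"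
      proof (rule equals0I)
        fix Y assume "Y \<in> {Y. C \<inter> A \<subseteq> Y \<and> Y \<subseteq> Z \<inter> A \<and> card Y = p}"
        then show False
          using False ij(1) card_mono[of Y "C \<inter> A"] finite_subset[OF _ fZAB(1), of Y] by simp
      qed
      then show ?thesis using False unfolding 1 by (simp only: card.empty of_nat_0 mult_zero_right if_False)
    qed
  qed
  have G: "(\<Sum>Y | Y \<subseteq> Z \<inter> B \<and> card Y = p. ?g Y) = (if j \<le> p then g (p - j) * of_nat ((card (Z \<inter> B) - j) choose (p - j)) else 0)" for p
  proof -
    have "(\<Sum>Y | Y \<subseteq> Z \<inter> B \<and> card Y = p. ?g Y)
      = (\<Sum>Y | Y \<subseteq> Z \<inter> B \<and> card Y = p. if C \<inter> B \<subseteq> Y then g (p - j) else 0)"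
      by (rule sum.cong) auto
    also have "\<dots> = (\<Sum>Y | (Y \<subseteq> Z \<inter> B \<and> card Y = p) \<and> C \<inter> B \<subseteq> Y. g (p - j))"
      by (rule sum_Collect_if[OF fin[OF fZAB(2)]])
    also have "\<dots> = (\<Sum>Y | C \<inter> B \<subseteq> Y \<and> Y \<subseteq> Z \<inter> B \<and> card Y = p. g (p - j))"
      by (rule sum.cong) auto
    finally have 1: "(\<Sum>Y | Y \<subseteq> Z \<inter> B \<and> card Y = p. ?g Y)
      = g (p - j) * of_nat (card {Y. C \<inter> B \<subseteq> Y \<and> Y \<subseteq> Z \<inter> B \<and> card Y = p})"
      by (simp add: mult.commute)
    show ?thesis
    proof (cases "j \<le> p")
      case True
      have CX: "C \<inter> B \<subseteq> Z \<inter> B" using C by blast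
      have "card {Y. C \<inter> B \<subseteq> Y \<and> Y \<subseteq> Z \<inter> B \<and> card Y = p} = (card (Z \<inter> B) - j) choose (p - j)"
        using card_subset_interval[OF fZAB(2) CX, of p] True ij(2) by simp
      then show ?thesis unfolding 1 using True by simp
    next
      case False
      have "{Y. C \<inter> B \<subseteq> Y \<and> Y \<subseteq> Z \<inter> B \<and> card Y = p} = {}"
      proof (rule equals0I)
        fix Y assume "Y \<in> {Y. C \<inter> B \<subseteq> Y \<and> Y \<subseteq> Z \<inter> B \<and> card Y = p}"
        then show False
          using False ij(2) card_mono[of Y "C \<inter> B"] finite_subset[OF _ fZAB(2), of Y] by simp
      qed
      then show ?thesis using False unfolding 1 by (simp only: card.empty of_nat_0 mult_zero_right if_False)
    qed
  qed
  have "(\<Sum>Y | C \<subseteq> Y \<and> Y \<subseteq> Z \<and> card Y = k. g (card (Y \<inter> B) - j))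
    = (\<Sum>Y\<in>{Y\<in>{Y. Y \<subseteq> Z \<and> card Y = k}. C \<subseteq> Y}. g (card (Y \<inter> B) - j))"
    by (rule sum.cong) auto
  also have "\<dots> = (\<Sum>Y\<in>{Y. Y \<subseteq> Z \<and> card Y = k}. if C \<subseteq> Y then g (card (Y \<inter> B) - j) else 0)"
    by (rule sum.inter_filter[OF fin[OF fZ]])
  also have "\<dots> = (\<Sum>Y | Y \<subseteq> (Z \<inter> A) \<union> (Z \<inter> B) \<and> card Y = k. ?f (Y \<inter> (Z \<inter> A)) * ?g (Y \<inter> (Z \<inter> B)))"
  proof (rule sum.cong)
    fix Y assume "Y \<in> {Y. Y \<subseteq> (Z \<inter> A) \<union> (Z \<inter> B) \<and> card Y = k}"
    then have Y: "Y \<subseteq> Z" by auto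
    then have "C \<subseteq> Y \<longleftrightarrow> C \<inter> A \<subseteq> Y \<inter> (Z \<inter> A) \<and> C \<inter> B \<subseteq> Y \<inter> (Z \<inter> B)" "Y \<inter> (Z \<inter> B) = Y \<inter> B"
      using C Z by blast+
    then show "(if C \<subseteq> Y then g (card (Y \<inter> B) - j) else 0) = ?f (Y \<inter> (Z \<inter> A)) * ?g (Y \<inter> (Z \<inter> B))"
      by simp
  qed (use fZAB in simp)
  also have "\<dots> = (\<Sum>w\<le>k. (if i \<le> k - w then 1 * of_nat ((card (Z \<inter> A) - i) choose (k - w - i)) else 0) *
      (if j \<le> w then g (w - j) * of_nat ((card (Z \<inter> B) - j) choose (w - j)) else 0))"
    unfolding F[symmetric] G[symmetric] by (rule sum_card_subsets_union[OF fZAB(1-3)])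
  also have "\<dots> = (\<Sum>w\<in>{j..k - i}. g (w - j) * of_nat ((card (Z \<inter> B) - j) choose (w - j)) * of_nat ((card (Z \<inter> A) - i) choose (k - w - i)))"
    using ij(3) by (intro sum.mono_neutral_cong_right) auto
  also have "\<dots> = (\<Sum>r\<le>k - i - j. g r * of_nat ((card (Z \<inter> B) - j) choose r) * of_nat ((card (Z \<inter> A) - i) choose (k - i - j - r)))"
    by (rule sum.reindex_bij_witness[where i = "\<lambda>r. r + j" and j = "\<lambda>w. w - j"])
      (use ij(3) in \<open>auto intro!: arg_cong2[where f = "(*)"] arg_cong2[where f = "(choose)"]\<close>)
  finally show ?thesis .
qed

text \<open>
  \<open>R\<^sub>m\<^sub>-\<^sub>k T\<^sub>k = T\<^sub>m\<close> on all functions of type \<open>(i, j)\<close>: after exchanging the summations the coefficient of \<open>F C\<close>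
  is the interval sum just computed, which is the expansion of the Hahn polynomial and does not depend on \<open>C\<close>.
\<close>

lemma R_map_intertwiner:
  assumes fin: "finite A" "finite B" and AB: "A \<inter> B = {}" and F: "F \<in> bi_mod A i B j"
    and k: "i + j \<le> k" "k \<le> m"
  shows "R_map (A \<union> B) (m - k) (intertwiner A i B j k k F) = intertwiner A i B j k m F"
proof
  fix Z
  let ?K = "k - i - j" and ?a = "card B - 2 * j" and ?b = "card A - 2 * i"
  let ?e = "\<lambda>r. of_int (hahn ?K ?a ?b ?K r) :: complex"
  show "R_map (A \<union> B) (m - k) (intertwiner A i B j k k F) Z = intertwiner A i B j k m F Z"
  proof (cases "Z \<subseteq> A \<union> B \<and> card Z = m")
    case False
    then show ?thesis using k
      by (auto simp: R_map_perm_mod[OF _ intertwiner_in_perm_mod] fin intertwiner_def[of _ _ _ _ _ m])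
  next
    case True
    then have fZ: "finite Z" using fin by (auto intro: finite_subset)
    let ?h = "of_int (hahn ?K ?a ?b (m - i - j) (card (Z \<inter> B) - j)) :: complex"
    have "R_map (A \<union> B) (m - k) (intertwiner A i B j k k F) Z = zeta (intertwiner A i B j k k F) Z"
      using True k by (simp add: R_map_perm_mod[OF _ intertwiner_in_perm_mod] fin)
    also have "\<dots> = (\<Sum>Y\<in>Pow Z. (if card Y = k then ?e (card (Y \<inter> B) - j) else 0) * zeta F Y)"
      unfolding zeta_def[of "intertwiner A i B j k k F"] using True by (intro sum.cong) (auto simp: intertwiner_def)
    also have "\<dots> = (\<Sum>C\<in>Pow Z. F C * (\<Sum>Y | C \<subseteq> Y \<and> Y \<subseteq> Z. if card Y = k then ?e (card (Y \<inter> B) - j) else 0))"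
      by (rule sum_zeta_swap[OF fZ])
    also have "\<dots> = (\<Sum>C\<in>Pow Z. ?h * F C)"
    proof (rule sum.cong[OF refl])
      fix C assume C: "C \<in> Pow Z"
      show "F C * (\<Sum>Y | C \<subseteq> Y \<and> Y \<subseteq> Z. if card Y = k then ?e (card (Y \<inter> B) - j) else 0) = ?h * F C"
      proof (cases "F C = 0")
        case False
        then have c: "card (C \<inter> A) = i" "card (C \<inter> B) = j" using F by (auto simp: bi_mod_def)
        have le: "i \<le> card (Z \<inter> A)" "j \<le> card (Z \<inter> B)"
          using C fZ unfolding c[symmetric] by (auto intro!: card_mono)
        have cZ: "card (Z \<inter> A) + card (Z \<inter> B) = m"
          using card_union_split[OF fZ AB] True by simp
        let ?x = "card (Z \<inter> B) - j"
        have cx: "card (Z \<inter> A) - i = m - i - j - ?x" using le cZ by simp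
        have "(\<Sum>Y | C \<subseteq> Y \<and> Y \<subseteq> Z. if card Y = k then ?e (card (Y \<inter> B) - j) else 0)
           = (\<Sum>Y\<in>{Y\<in>{Y. C \<subseteq> Y \<and> Y \<subseteq> Z}. card Y = k}. ?e (card (Y \<inter> B) - j))"
          by (rule sum.inter_filter[symmetric]) (rule finite_subset[of _ "Pow Z"], use fZ in auto)
        also have "\<dots> = (\<Sum>Y | C \<subseteq> Y \<and> Y \<subseteq> Z \<and> card Y = k. ?e (card (Y \<inter> B) - j))"
          by (rule sum.cong) auto
        also have "\<dots> = (\<Sum>r\<le>?K. ?e r * of_nat (?x choose r) * of_nat ((card (Z \<inter> A) - i) choose (?K - r)))"
          using True C c k by (intro sum_interval_union[OF fZ AB]) auto
        also have "\<dots> = of_int (\<Sum>r\<le>?K. lead_hahn ?K ?a ?b r * int (?x choose r) * int ((m - i - j - ?x) choose (?K - r)))"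
          unfolding cx of_int_sum by (rule sum.cong) (auto simp: hahn_lead)
        also have "\<dots> = ?h"
          using le cZ by (subst hahn_eq_sum_lead_hahn) auto
        finally show ?thesis by simp
      qed simp
    qed
    also have "\<dots> = intertwiner A i B j k m F Z"
      using True by (simp add: intertwiner_def zeta_def sum_distrib_left)
    finally show ?thesis .
  qed
qed

section \<open>Linear maps on spans\<close>

lemma subspace_specht: "fun_vs.subspace (specht X p)"
proof -
  \<comment> \<open>The case of an empty second factor.\<close>
  have "perm_mod X p = bi_mod X p {} 0"
    unfolding perm_mod_def bi_mod_def by (auto simp: Int_absorb2)
  then have "fun_vs.subspace (perm_mod X p)" using subspace_bi_mod[of X p "{}" 0] by simp
  moreover have "d_map X 0 = 0" using d_map_linear[of X]
    unfolding linear_map_on_def by (metis UNIV_I fun_vs.scale_zero_left)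
  ultimately show ?thesis using d_map_linear[of X]
    unfolding linear_map_on_def fun_vs.subspace_def specht_def by simp
qed

lemma linear_map_on_0:
  assumes "linear_map_on V L" "0 \<in> V"
  shows "L 0 = 0"
  using assms unfolding linear_map_on_def by (metis fun_vs.scale_zero_left)

lemma subspace_preimage:
  assumes "linear_map_on UNIV L" "fun_vs.subspace S"
  shows "fun_vs.subspace {f. L f \<in> S}"
proof (rule fun_vs.subspaceI)
  show "0 \<in> {f. L f \<in> S}"
    using linear_map_on_0[OF assms(1)] fun_vs.subspace_0[OF assms(2)] by (metis UNIV_I mem_Collect_eq)
next
  fix f g assume "f \<in> {f. L f \<in> S}" "g \<in> {f. L f \<in> S}"
  then show "f + g \<in> {f. L f \<in> S}"
    using assms(1) fun_vs.subspace_add[OF assms(2)] unfolding linear_map_on_def by (metis UNIV_I mem_Collect_eq)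
next
  fix c f assume "f \<in> {f. L f \<in> S}"
  then show "fscale c f \<in> {f. L f \<in> S}"
    using assms(1) fun_vs.subspace_scale[OF assms(2)] unfolding linear_map_on_def by (metis UNIV_I mem_Collect_eq)
qed

lemma linear_maps_eq_on_span:
  assumes T: "linear_map_on (fun_vs.span S) T" and U: "linear_map_on (fun_vs.span S) U"
    and eq: "\<And>f. f \<in> S \<Longrightarrow> T f = U f" and F: "F \<in> fun_vs.span S"
  shows "T F = U F"
proof -
  have "F \<in> fun_vs.span S \<and> T F = U F"
    using F
  proof (induction rule: fun_vs.span_induct_alt)
    case base
    show ?case using linear_map_on_0[OF T] linear_map_on_0[OF U] fun_vs.span_zero by metis
  next
    case (step c f g)
    then have f: "f \<in> fun_vs.span S" "fscale c f \<in> fun_vs.span S" and g: "g \<in> fun_vs.span S" "T g = U g"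
      by (auto intro: fun_vs.span_base fun_vs.span_scale)
    have "V (fscale c f + g) = fscale c (V f) + V g" if "linear_map_on (fun_vs.span S) V"
      for V :: "('a \<Rightarrow> complex) \<Rightarrow> ('b \<Rightarrow> complex)"
      using that f g unfolding linear_map_on_def by metis
    from this[OF T] this[OF U] have "T (fscale c f + g) = U (fscale c f + g)"
      unfolding eq[OF step(1)] g(2) by (rule trans[OF _ sym])
    then show ?case using fun_vs.span_add[OF f(2) g(1)] by (rule conjI[rotated])
  qed
  then show ?thesis ..
qed

section \<open>Range, norm and injectivity\<close>

text \<open>
  The parameters of the theorem except \<open>m\<close>, with \<open>h = |A|\<close> and \<open>n - h = |B|\<close>. The last two inequalities say \<open>K \<le> b\<close> and \<open>K \<le> a\<close> and are the condition
  for \<open>S\<^sup>h\<^sup>-\<^sup>i\<^sup>,\<^sup>i(A) \<otimes> S\<^sup>n\<^sup>-\<^sup>h\<^sup>-\<^sup>j\<^sup>,\<^sup>j(B)\<close> to occur in the restriction of \<open>S\<^sup>n\<^sup>-\<^sup>k\<^sup>,\<^sup>k\<close>, given \<open>i + j \<le> k\<close>.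
\<close>

locale branching =
  fixes A B :: "'a set" and i j k :: nat
  assumes finite_A: "finite A" and finite_B: "finite B" and disjoint: "A \<inter> B = {}"
    and i_le: "2 * i \<le> card A" and j_le: "2 * j \<le> card B" and ij_le_k: "i + j \<le> k"
    and k_le_A: "k + i \<le> card A + j" and k_le_B: "k + j \<le> card B + i"
begin

abbreviation "K \<equiv> k - i - j"
abbreviation "a \<equiv> card B - 2 * j"
abbreviation "b \<equiv> card A - 2 * i"
abbreviation "T \<equiv> intertwiner A i B j k"

lemma K_le: "K \<le> a" "K \<le> b"
  using i_le j_le ij_le_k k_le_A k_le_B by linarith+

lemma finite_sub: "Z \<subseteq> A \<union> B \<Longrightarrow> finite Z"
  using finite_A finite_B finite_subset by blast

lemma card_split: "Z \<subseteq> A \<union> B \<Longrightarrow> card Z = card (Z \<inter> A) + card (Z \<inter> B)"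
  by (rule card_union_split[OF finite_sub disjoint])

lemma zeta_tensor_specht:
  assumes "\<phi> \<in> specht A i" "\<psi> \<in> specht B j" "Z \<subseteq> A \<union> B"
  shows "zeta (tensor A i B j \<phi> \<psi>) Z = zeta \<phi> (Z \<inter> A) * zeta \<psi> (Z \<inter> B)"
  using assms by (intro zeta_tensor finite_A finite_B disjoint) (auto simp: specht_def)

text \<open>
  Outside these bounds one of the two subset sums has too few or too many points. This explains the range of \<open>w\<close> in
  the definition of \<open>T\<^sub>m\<close>.
\<close>

lemma zeta_tensor_support:
  assumes "\<phi> \<in> specht A i" "\<psi> \<in> specht B j" "Z \<subseteq> A \<union> B"
    and nz: "zeta \<phi> (Z \<inter> A) * zeta \<psi> (Z \<inter> B) \<noteq> 0"
  shows "i \<le> card (Z \<inter> A)" "card (Z \<inter> A) + i \<le> card A" "j \<le> card (Z \<inter> B)" "card (Z \<inter> B) + j \<le> card B"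
proof -
  have fin: "finite (Z \<inter> A)" "finite (Z \<inter> B)" using finite_A finite_B by auto
  have p: "\<phi> \<in> perm_mod A i" "\<psi> \<in> perm_mod B j" using assms by (auto simp: specht_def)
  show "i \<le> card (Z \<inter> A)" using zeta_eq_0_if_small[OF p(1) fin(1)] nz by (metis mult_zero_left not_le)
  show "j \<le> card (Z \<inter> B)" using zeta_eq_0_if_small[OF p(2) fin(2)] nz by (metis mult_zero_right not_le)
  show "card (Z \<inter> A) + i \<le> card A"
    using zeta_specht_eq_0_if_large[OF finite_A assms(1) i_le, of "Z \<inter> A"] nz by (metis mult_zero_left not_le Int_lower2)
  show "card (Z \<inter> B) + j \<le> card B"
    using zeta_specht_eq_0_if_large[OF finite_B assms(2) j_le, of "Z \<inter> B"] nz by (metis mult_zero_right not_le Int_lower2)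
qed

text \<open>
  For a given \<open>Z\<close> only \<open>w = |Z \<inter> B|\<close> contributes to the sum, and if this \<open>w\<close> is out of range then \<open>\<zeta> (\<phi> \<otimes> \<psi>)\<close>
  vanishes at \<open>Z\<close>.
\<close>

lemma intertwiner_tensor:
  assumes \<phi>: "\<phi> \<in> specht A i" and \<psi>: "\<psi> \<in> specht B j" and m: "i \<le> m"
  shows "T m (tensor A i B j \<phi> \<psi>) =
    (\<Sum>w = max j (m + i - card A)..min (card B - j) (m - i).
       fscale (of_int (hahn K a b (m - i - j) (w - j)))
         (tensor A (m - w) B w (R_map A (m - w - i) \<phi>) (R_map B (w - j) \<psi>)))" (is "_ = (\<Sum>w\<in>?W. ?t w)")
proof
  fix Z
  let ?h = "\<lambda>w. of_int (hahn K a b (m - i - j) (w - j)) :: complex"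
  have p: "\<phi> \<in> perm_mod A i" "\<psi> \<in> perm_mod B j" using \<phi> \<psi> by (auto simp: specht_def)
  show "T m (tensor A i B j \<phi> \<psi>) Z = (\<Sum>w\<in>?W. ?t w) Z"
  proof (cases "Z \<subseteq> A \<union> B \<and> card Z = m")
    case False
    then have "?t w Z = 0" if "w \<in> ?W" for w
      using that m by (auto simp: fscale_def tensor_def)
    then show ?thesis using False by (auto simp: intertwiner_def sum_fun_apply)
  next
    case True
    define v where "v = card (Z \<inter> B)"
    let ?z = "zeta \<phi> (Z \<inter> A) * zeta \<psi> (Z \<inter> B)"
    have v: "card (Z \<inter> A) = m - v" "v \<le> m" using card_split[of Z] True by (auto simp: v_def)
    have cB: "card (Z \<inter> B) = v" by (simp add: v_def)
    have t: "?t w Z = (if w = v then ?h v * ?z else 0)" if w: "w \<in> ?W" for w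
    proof (cases "w = v")
      case eq: True
      have w': "j \<le> v" "i \<le> m - v" using w m unfolding eq by auto
      have "R_map A (m - v - i) \<phi> (Z \<inter> A) = zeta \<phi> (Z \<inter> A)"
        using R_map_perm_mod[OF finite_A p(1), of "m - v - i" "Z \<inter> A"] v w' by simp
      moreover have "R_map B (v - j) \<psi> (Z \<inter> B) = zeta \<psi> (Z \<inter> B)"
        using R_map_perm_mod[OF finite_B p(2), of "v - j" "Z \<inter> B"] cB w' by simp
      moreover have "Z \<subseteq> A \<union> B" "card Z = m - v + v" using True v(2) by auto
      ultimately show ?thesis unfolding eq by (simp only: fscale_def tensor_def v(1) simp_thms if_True)
    next
      case neq: False
      have "w \<le> m" using w m by auto
      then have "m - v \<noteq> m - w" using neq v(2) by linarith
      then show ?thesis using neq by (simp add: fscale_def tensor_def v(1))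
    qed
    have "(\<Sum>w\<in>?W. ?t w) Z = (if v \<in> ?W then ?h v * ?z else 0)"
      unfolding sum_fun_apply by (subst sum.cong[OF refl t]) (auto simp: sum.delta)
    also have "\<dots> = ?h v * ?z"
    proof (cases "?z = 0")
      case False
      have "v \<in> ?W"
        using zeta_tensor_support[OF \<phi> \<psi> conjunct1[OF True] False] v
        unfolding cB v(1) atLeastAtMost_iff max.bounded_iff min.bounded_iff by linarith
      then show ?thesis by simp
    qed simp
    finally show ?thesis
      using True zeta_tensor_specht[OF \<phi> \<psi>, of Z] by (simp add: intertwiner_def v_def)
  qed
qed

text \<open>
  Extending \<open>Z\<close> by a point of \<open>A\<close> keeps \<open>r = |Z \<inter> B| - j\<close>, and extending it by a point of \<open>B\<close> raises it by one. By
  \<open>sum_insert_zeta_specht\<close> both kinds of extensions sum to multiples of \<open>(\<zeta> \<phi>)(Z \<inter> A) (\<zeta> \<psi>)(Z \<inter> B)\<close>, and by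
  \<open>lead_hahn_rec\<close> the total coefficient is \<open>0\<close>.
\<close>

lemma d_map_intertwiner_tensor:
  assumes \<phi>: "\<phi> \<in> specht A i" and \<psi>: "\<psi> \<in> specht B j"
  shows "d_map (A \<union> B) (T k (tensor A i B j \<phi> \<psi>)) = 0"
proof
  fix Z
  have fin: "finite (A \<union> B)" using finite_A finite_B by simp
  let ?F = "tensor A i B j \<phi> \<psi>"
  let ?h = "\<lambda>r. of_int (hahn K a b K r) :: complex"
  show "d_map (A \<union> B) (T k ?F) Z = 0 Z"
  proof (cases "Z \<subseteq> A \<union> B \<and> Suc (card Z) = k")
    case False
    then show ?thesis
      by (auto simp: d_map_apply[OF fin] intertwiner_def finite_sub intro!: sum.neutral)
  next
    case True
    then have Z: "Z \<subseteq> A \<union> B" and fZ: "finite Z" using finite_sub by auto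
    let ?ZA = "Z \<inter> A" and ?ZB = "Z \<inter> B"
    have step: "T k ?F (insert x Z) = ?h (card (insert x Z \<inter> B) - j) * (zeta \<phi> (insert x Z \<inter> A) * zeta \<psi> (insert x Z \<inter> B))"
      if "x \<in> A \<union> B" "x \<notin> Z" for x
      using that True fZ by (subst zeta_tensor_specht[OF \<phi> \<psi>, symmetric]) (auto simp: intertwiner_def)
    have stepA: "T k ?F (insert x Z) = ?h (card ?ZB - j) * zeta \<psi> ?ZB * zeta \<phi> (insert x ?ZA)" if "x \<in> A - ?ZA" for x
    proof -
      have eq: "insert x Z \<inter> B = ?ZB" "insert x Z \<inter> A = insert x ?ZA" using that disjoint by auto
      have "x \<in> A \<union> B" "x \<notin> Z" using that by auto
      from step[OF this] show ?thesis unfolding eq by (simp only: mult_ac)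
    qed
    have stepB: "T k ?F (insert x Z) = ?h (Suc (card ?ZB) - j) * zeta \<phi> ?ZA * zeta \<psi> (insert x ?ZB)" if "x \<in> B - ?ZB" for x
    proof -
      have eq: "insert x Z \<inter> A = ?ZA" "insert x Z \<inter> B = insert x ?ZB" using that disjoint by auto
      have c: "card (insert x ?ZB) = Suc (card ?ZB)"
        by (rule card_insert_disjoint) (use that fZ in auto)
      have "x \<in> A \<union> B" "x \<notin> Z" using that by auto
      from step[OF this] show ?thesis unfolding eq c by (simp only: mult_ac)
    qed
    have "d_map (A \<union> B) (T k ?F) Z = (\<Sum>x\<in>(A - ?ZA) \<union> (B - ?ZB). T k ?F (insert x Z))"
      using Z by (simp add: d_map_apply[OF fin]) (rule sum.cong, use disjoint in auto)
    also have "\<dots> = (\<Sum>x\<in>A - ?ZA. T k ?F (insert x Z)) + (\<Sum>x\<in>B - ?ZB. T k ?F (insert x Z))"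
      using finite_A finite_B disjoint by (intro sum.union_disjoint) auto
    also have "(\<Sum>x\<in>A - ?ZA. T k ?F (insert x Z)) = ?h (card ?ZB - j) * zeta \<psi> ?ZB * (\<Sum>x\<in>A - ?ZA. zeta \<phi> (insert x ?ZA))"
      unfolding sum_distrib_left by (rule sum.cong[OF refl stepA])
    also have "(\<Sum>x\<in>B - ?ZB. T k ?F (insert x Z)) = ?h (Suc (card ?ZB) - j) * zeta \<phi> ?ZA * (\<Sum>x\<in>B - ?ZB. zeta \<psi> (insert x ?ZB))"
      unfolding sum_distrib_left by (rule sum.cong[OF refl stepB])
    also have "(\<Sum>x\<in>A - ?ZA. zeta \<phi> (insert x ?ZA)) = (of_nat (card A) - of_nat (card ?ZA) - of_nat i) * zeta \<phi> ?ZA"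
      by (rule sum_insert_zeta_specht[OF finite_A \<phi>]) simp
    also have "(\<Sum>x\<in>B - ?ZB. zeta \<psi> (insert x ?ZB)) = (of_nat (card B) - of_nat (card ?ZB) - of_nat j) * zeta \<psi> ?ZB"
      by (rule sum_insert_zeta_specht[OF finite_B \<psi>]) simp
    finally have d: "d_map (A \<union> B) (T k ?F) Z =
      (?h (card ?ZB - j) * (of_nat (card A) - of_nat (card ?ZA) - of_nat i)
        + ?h (Suc (card ?ZB) - j) * (of_nat (card B) - of_nat (card ?ZB) - of_nat j)) * (zeta \<phi> ?ZA * zeta \<psi> ?ZB)"
      by (simp add: algebra_simps)
    show ?thesis
    proof (cases "zeta \<phi> ?ZA * zeta \<psi> ?ZB = 0")
      case True
      then show ?thesis unfolding d by simp
    next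
      case False
      note s = zeta_tensor_support[OF \<phi> \<psi> Z False]
      define r where "r = card ?ZB - j"
      \<comment> \<open>The bounds of \<open>zeta_tensor_support\<close> give \<open>r < K\<close>, where the recursion applies.\<close>
      have r: "card ?ZB = j + r" "Suc (card ?ZB) - j = Suc r" "card ?ZA + j + r + 1 = k" "r < K"
        using s True card_split[OF Z] by (auto simp: r_def)
      have "int (card A) - int (card ?ZA) - int i = int b - int K + int r + 1"
        "int (card B) - int (card ?ZB) - int j = int a - int r"
        using r i_le j_le ij_le_k by (auto simp: of_nat_diff)
      then have c: "of_nat (card A) - of_nat (card ?ZA) - of_nat i = (of_int (int b - int K + int r + 1) :: complex)"
        "of_nat (card B) - of_nat (card ?ZB) - of_nat j = (of_int (int a - int r) :: complex)"
        by (metis of_int_diff of_int_of_nat_eq)+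
      have "?h (card ?ZB - j) * (of_nat (card A) - of_nat (card ?ZA) - of_nat i)
        + ?h (Suc (card ?ZB) - j) * (of_nat (card B) - of_nat (card ?ZB) - of_nat j)
        = of_int (lead_hahn K a b r * (int b - int K + int r + 1) + lead_hahn K a b (Suc r) * (int a - int r))"
        unfolding c r(2) r_def[symmetric] of_int_add of_int_mult using r(4) by (simp add: hahn_lead)
      also have "\<dots> = 0" unfolding lead_hahn_rec[OF r(4)] by simp
      finally show ?thesis unfolding d by (simp only: mult_zero_left zero_fun_apply)
    qed
  qed
qed

lemma intertwiner_in_specht:
  assumes "F \<in> specht_tensor A i B j"
  shows "T k F \<in> specht (A \<union> B) k"
proof -
  let ?S = "{tensor A i B j \<phi> \<psi> | \<phi> \<psi>. \<phi> \<in> specht A i \<and> \<psi> \<in> specht B j}"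
  have "fun_vs.subspace {F. T k F \<in> specht (A \<union> B) k}"
    by (rule subspace_preimage[OF intertwiner_linear subspace_specht])
  moreover have "?S \<subseteq> {F. T k F \<in> specht (A \<union> B) k}"
    using d_map_intertwiner_tensor intertwiner_in_perm_mod by (auto simp: specht_def)
  ultimately have "fun_vs.span ?S \<subseteq> {F. T k F \<in> specht (A \<union> B) k}"
    by (intro fun_vs.span_minimal)
  then show ?thesis using assms by (auto simp: specht_tensor_def)
qed

text \<open>
  The sets with different \<open>|Z \<inter> B|\<close> contribute separately, and each contribution is a product of the norms of
  \<open>R\<^sub>K\<^sub>-\<^sub>r \<phi>\<close> and \<open>R\<^sub>r \<psi>\<close>.
\<close>

lemma norm_intertwiner_tensor:
  assumes \<phi>: "\<phi> \<in> specht A i" and \<psi>: "\<psi> \<in> specht B j"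
  shows "M_inner (A \<union> B) k (T k (tensor A i B j \<phi> \<psi>)) (T k (tensor A i B j \<phi> \<psi>))
    = of_real (\<Sum>r\<le>K. (real_of_int (lead_hahn K a b r))\<^sup>2 * real (b choose (K - r)) * real (a choose r))
      * M_inner A i \<phi> \<phi> * M_inner B j \<psi> \<psi>"
proof -
  let ?F = "T k (tensor A i B j \<phi> \<psi>)"
  let ?h = "\<lambda>r. of_int (hahn K a b K r) :: complex"
  let ?f = "\<lambda>Y. zeta \<phi> Y * cnj (zeta \<phi> Y)" and ?g = "\<lambda>Y. (?h (card Y - j))\<^sup>2 * (zeta \<psi> Y * cnj (zeta \<psi> Y))"
  have p: "\<phi> \<in> perm_mod A i" "\<psi> \<in> perm_mod B j" using \<phi> \<psi> by (auto simp: specht_def)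
  let ?SA = "\<lambda>p. \<Sum>Y | Y \<subseteq> A \<and> card Y = p. ?f Y" and ?SB = "\<lambda>p. \<Sum>Y | Y \<subseteq> B \<and> card Y = p. ?g Y"
  \<comment> \<open>These two facts restrict the convolution to \<open>j \<le> w \<le> k - i\<close>, that is, \<open>w = j + r\<close> with \<open>r \<le> K\<close>.\<close>
  have A0: "?SA p = 0" if "p < i" for p
    using that finite_subset[OF _ finite_A] by (intro sum.neutral) (auto simp: zeta_eq_0_if_small[OF p(1)])
  have B0: "?SB p = 0" if "p < j" for p
    using that finite_subset[OF _ finite_B] by (intro sum.neutral) (auto simp: zeta_eq_0_if_small[OF p(2)])
  have SA: "?SA (i + q) = of_nat (b choose q) * M_inner A i \<phi> \<phi>" for q
    by (rule norm_zeta_specht[OF finite_A \<phi> i_le])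
  have SB: "?SB (j + q) = (?h q)\<^sup>2 * (of_nat (a choose q) * M_inner B j \<psi> \<psi>)" for q
    unfolding norm_zeta_specht[OF finite_B \<psi> j_le, symmetric] sum_distrib_left
    by (rule sum.cong) auto
  have "M_inner (A \<union> B) k ?F ?F = (\<Sum>Z | Z \<subseteq> A \<union> B \<and> card Z = k. ?f (Z \<inter> A) * ?g (Z \<inter> B))"
    unfolding M_inner_def
    by (rule sum.cong) (auto simp: intertwiner_def zeta_tensor_specht[OF \<phi> \<psi>] power2_eq_square mult_ac)
  also have "\<dots> = (\<Sum>w\<le>k. ?SA (k - w) * ?SB w)"
    by (rule sum_card_subsets_union[OF finite_A finite_B disjoint])
  also have "\<dots> = (\<Sum>w\<in>{j..k - i}. ?SA (k - w) * ?SB w)"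
  proof (rule sum.mono_neutral_right)
    show "\<forall>w\<in>{..k} - {j..k - i}. ?SA (k - w) * ?SB w = 0"
    proof
      fix w assume w: "w \<in> {..k} - {j..k - i}"
      show "?SA (k - w) * ?SB w = 0"
      proof (cases "w < j")
        case True
        show ?thesis unfolding B0[OF True] by (rule mult_zero_right)
      next
        case False
        then have "k - w < i" using w by auto
        then show ?thesis unfolding A0 by (simp only: A0 mult_zero_left)
      qed
    qed
  qed auto
  also have "\<dots> = (\<Sum>r\<le>K. ?SA (i + (K - r)) * ?SB (j + r))"
    by (rule sum.reindex_bij_witness[where i = "\<lambda>r. j + r" and j = "\<lambda>w. w - j"])
      (use ij_le_k in auto)
  also have "\<dots> = (\<Sum>r\<le>K. of_real ((real_of_int (lead_hahn K a b r))\<^sup>2 * real (b choose (K - r)) * real (a choose r))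
      * (M_inner A i \<phi> \<phi> * M_inner B j \<psi> \<psi>))"
    unfolding SA SB by (rule sum.cong) (auto simp: hahn_lead)
  finally show ?thesis by (simp only: of_real_sum sum_distrib_right mult.assoc)
qed

text \<open>
  Slicing \<open>\<phi> \<otimes> \<psi>\<close> along \<open>C\<close> gives \<open>\<psi>(C) \<phi>\<close>, and the kernel of \<open>d\<close> is a subspace.
\<close>

lemma slice_in_specht:
  assumes "F \<in> specht_tensor A i B j" "C \<subseteq> B"
  shows "(\<lambda>Y. if Y \<subseteq> A then F (Y \<union> C) else 0) \<in> specht A i"
proof -
  let ?s = "\<lambda>F Y. if Y \<subseteq> A then F (Y \<union> C) else 0 :: complex"
  let ?S = "{tensor A i B j \<phi> \<psi> | \<phi> \<psi>. \<phi> \<in> specht A i \<and> \<psi> \<in> specht B j}"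
  have "linear_map_on UNIV ?s"
    by (auto simp: linear_map_on_def fun_eq_iff fscale_def)
  then have "fun_vs.subspace {F. ?s F \<in> specht A i}"
    using subspace_specht by (rule subspace_preimage)
  moreover have "?s (tensor A i B j \<phi> \<psi>) \<in> specht A i" if "\<phi> \<in> specht A i" "\<psi> \<in> specht B j" for \<phi> \<psi>
  proof -
    have p: "\<phi> \<in> perm_mod A i" "\<psi> \<in> perm_mod B j" using that by (auto simp: specht_def)
    have "?s (tensor A i B j \<phi> \<psi>) = fscale (\<psi> C) \<phi>"
    proof
      fix Y
      show "?s (tensor A i B j \<phi> \<psi>) Y = fscale (\<psi> C) \<phi> Y"
      proof (cases "Y \<subseteq> A")
        case True
        then have "(Y \<union> C) \<inter> A = Y" "(Y \<union> C) \<inter> B = C" "Y \<union> C \<subseteq> A \<union> B" using assms(2) disjoint by auto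
        then show ?thesis using True
          by (simp add: tensor_apply[OF finite_A finite_B disjoint p] fscale_def)
      next
        case False
        then show ?thesis using p by (auto simp: fscale_def perm_mod_def)
      qed
    qed
    then show ?thesis using that subspace_specht[of A i] by (simp add: fun_vs.subspace_scale)
  qed
  ultimately have "fun_vs.span ?S \<subseteq> {F. ?s F \<in> specht A i}"
    by (intro fun_vs.span_minimal) auto
  then show ?thesis using assms(1) by (auto simp: specht_tensor_def)
qed

text \<open>
  On the sets \<open>Z \<union> C\<close> with \<open>Z \<subseteq> A\<close>, \<open>C \<subseteq> B\<close> and \<open>|C| = j\<close>, the only subsets that contribute to \<open>\<zeta> F\<close> contain \<open>C\<close>.
  So \<open>T\<^sub>k F = 0\<close> forces \<open>R\<^sub>K\<close> of every slice of \<open>F\<close> to vanish, hence the slice itself.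
\<close>

lemma intertwiner_k_eq_0_imp:
  assumes F: "F \<in> specht_tensor A i B j" and 0: "T k F = 0"
  shows "F = 0"
proof -
  have bi: "F \<in> bi_mod A i B j"
    using F specht_tensor_subset_bi_mod[OF finite_A finite_B disjoint] by blast
  let ?s = "\<lambda>C Y. if Y \<subseteq> A then F (Y \<union> C) else 0 :: complex"
  have s0: "?s C = 0" if C: "C \<subseteq> B" "card C = j" for C
  proof (rule specht_eq_0_if_zeta_eq_0[OF finite_A slice_in_specht[OF F C(1)]])
    show "2 * i + K \<le> card A" using K_le i_le by linarith
    fix Z assume Z: "Z \<subseteq> A" "card Z = i + K"
    have ZC: "(Z \<union> C) \<inter> B = C" "Z \<union> C \<subseteq> A \<union> B" using Z C disjoint by auto
    have "card (Z \<union> C) = card Z + card C"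
      using Z C disjoint finite_A finite_B by (intro card_Un_disjoint) (auto intro: finite_subset)
    then have "card (Z \<union> C) = k" using Z C ij_le_k by simp
    then have "0 = of_int (lead_hahn K a b 0) * zeta F (Z \<union> C)"
      using fun_cong[OF 0, of "Z \<union> C"] ZC C by (simp add: intertwiner_def hahn_lead)
    then have "zeta F (Z \<union> C) = 0" using lead_hahn_nonzero[OF K_le] by simp
    also have "zeta F (Z \<union> C) = (\<Sum>Y\<in>(\<lambda>Y. Y \<union> C) ` Pow Z. F Y)"
      unfolding zeta_def
    proof (rule sum.mono_neutral_right)
      show "finite (Pow (Z \<union> C))" using finite_sub[OF ZC(2)] by simp
      show "\<forall>Y\<in>Pow (Z \<union> C) - (\<lambda>Y. Y \<union> C) ` Pow Z. F Y = 0"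
      proof (rule ballI, rule ccontr)
        fix Y assume Y: "Y \<in> Pow (Z \<union> C) - (\<lambda>Y. Y \<union> C) ` Pow Z" "F Y \<noteq> 0"
        then have c: "card (Y \<inter> B) = j" using bi by (auto simp: bi_mod_def)
        have "Y \<inter> B \<subseteq> C" using Y ZC by auto
        then have "Y \<inter> B = C" using c C card_subset_eq[OF finite_subset[OF C(1) finite_B]] by simp
        then have "Y = (Y \<inter> Z) \<union> C" using Y Z(1) C(1) disjoint by auto
        then show False using Y by blast
      qed
    qed auto
    also have "\<dots> = (\<Sum>Y\<in>Pow Z. F (Y \<union> C))"
      using Z C disjoint by (intro sum.reindex_cong[of "\<lambda>Y. Y \<union> C"]) (auto simp: inj_on_def, blast+)
    also have "\<dots> = zeta (?s C) Z"
      unfolding zeta_def using Z by (intro sum.cong) auto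
    finally show "zeta (?s C) Z = 0" .
  qed
  show ?thesis
  proof (rule ext, rule ccontr)
    fix Z assume nz: "F Z \<noteq> 0 Z"
    then have Z: "Z \<subseteq> A \<union> B" "card (Z \<inter> B) = j" using bi by (auto simp: bi_mod_def)
    have "(Z \<inter> A) \<union> (Z \<inter> B) = Z" using Z by blast
    then show False using fun_cong[OF s0[OF Int_lower2 Z(2)], of "Z \<inter> A"] nz by simp
  qed
qed

lemma card_union: "card (A \<union> B) = card A + card B"
  using finite_A finite_B disjoint by (simp add: card_Un_disjoint)

lemma two_k_le: "2 * k \<le> card (A \<union> B)"
  using card_union k_le_A k_le_B by linarith

lemma intertwiner_eq_R_map:
  assumes "F \<in> specht_tensor A i B j" "k \<le> m"
  shows "T m F = R_map (A \<union> B) (m - k) (T k F)"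
proof -
  have "F \<in> bi_mod A i B j"
    using specht_tensor_subset_bi_mod[OF finite_A finite_B disjoint] assms(1) by (rule subsetD)
  from R_map_intertwiner[OF finite_A finite_B disjoint this ij_le_k assms(2)] show ?thesis by (rule sym)
qed

text \<open>
  \<open>T\<^sub>m\<close> is \<open>T\<^sub>k\<close> followed by \<open>R\<^sub>m\<^sub>-\<^sub>k\<close>, which is injective on the kernel of \<open>d\<close>.
\<close>

lemma intertwiner_eq_0_imp:
  assumes F: "F \<in> specht_tensor A i B j" and m: "k \<le> m" "m + k \<le> card (A \<union> B)" and 0: "T m F = 0"
  shows "F = 0"
proof (rule intertwiner_k_eq_0_imp[OF F], rule specht_eq_0_if_zeta_eq_0)
  show fin: "finite (A \<union> B)" using finite_A finite_B by simp
  show "2 * k + (m - k) \<le> card (A \<union> B)" using m by simp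
  show "T k F \<in> specht (A \<union> B) k" by (rule intertwiner_in_specht[OF F])
  have R: "R_map (A \<union> B) (m - k) (T k F) = 0"
    using intertwiner_eq_R_map[OF F m(1)] 0 by (rule trans[OF sym])
  fix Z assume Z: "Z \<subseteq> A \<union> B" "card Z = k + (m - k)"
  then have "zeta (T k F) Z = R_map (A \<union> B) (m - k) (T k F) Z"
    unfolding R_map_perm_mod[OF fin intertwiner_in_perm_mod] by (simp only: simp_thms if_True)
  then show "zeta (T k F) Z = 0" unfolding R by (simp only: zero_fun_apply)
qed

lemma norm_square_intertwiner:
  assumes \<phi>: "\<phi> \<in> specht A i" and \<psi>: "\<psi> \<in> specht B j" and m: "k \<le> m" "m + k \<le> card (A \<union> B)"
  defines "N \<equiv> a + b" and "c \<equiv> m - i - j"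
  shows "(M_norm (A \<union> B) m (T m (tensor A i B j \<phi> \<psi>)))\<^sup>2 =
    real (N choose c) * inverse (real (N choose K)) * ((real N - real K + 1) / (real N - 2 * real K + 1))
    * pochhammer (real a - real K + 1) K * pochhammer (real b - real K + 1) K
    * pochhammer (real c - real K + 1) K * pochhammer (real N - real c - real K + 1) K
    * (M_norm A i \<phi>)\<^sup>2 * (M_norm B j \<psi>)\<^sup>2"
proof -
  have fin: "finite (A \<union> B)" using finite_A finite_B by simp
  have self: "M_inner X p f f = of_real ((M_norm X p f)\<^sup>2)" for X :: "'a set" and p f
  proof -
    have "M_inner X p f f = of_real (\<Sum>C | C \<subseteq> X \<and> card C = p. (cmod (f C))\<^sup>2)"
      unfolding M_inner_def by (simp only: of_real_sum complex_norm_square)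
    moreover have "0 \<le> (\<Sum>C | C \<subseteq> X \<and> card C = p. (cmod (f C))\<^sup>2)" by (intro sum_nonneg) auto
    ultimately show ?thesis by (simp add: M_norm_def)
  qed
  let ?F = "tensor A i B j \<phi> \<psi>"
  have F: "?F \<in> specht_tensor A i B j"
    unfolding specht_tensor_def using \<phi> \<psi> by (intro fun_vs.span_base) blast
  have e: "card (A \<union> B) - 2 * k = N - 2 * K" "m - k = c - K" and km: "k + (m - k) = m"
    and Kc: "K \<le> c" "K + c \<le> N"
    using m i_le j_le ij_le_k card_union by (auto simp: N_def c_def)
  let ?s = "\<Sum>r\<le>K. (real_of_int (lead_hahn K a b r))\<^sup>2 * real (b choose (K - r)) * real (a choose r)"
  have "complex_of_real ((M_norm (A \<union> B) m (T m ?F))\<^sup>2) = of_nat ((N - 2 * K) choose (c - K)) * M_inner (A \<union> B) k (T k ?F) (T k ?F)"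
    using norm_R_map_specht[OF fin intertwiner_in_specht[OF F] two_k_le, of "m - k"]
    unfolding self[symmetric] intertwiner_eq_R_map[OF F m(1)] km unfolding e .
  also have "\<dots> = complex_of_real (real ((N - 2 * K) choose (c - K)) * ?s * (M_norm A i \<phi>)\<^sup>2 * (M_norm B j \<psi>)\<^sup>2)"
    unfolding norm_intertwiner_tensor[OF \<phi> \<psi>] unfolding self by (simp only: of_real_mult of_real_of_nat_eq mult.assoc)
  finally have "(M_norm (A \<union> B) m (T m ?F))\<^sup>2 = real ((N - 2 * K) choose (c - K)) * ?s * (M_norm A i \<phi>)\<^sup>2 * (M_norm B j \<psi>)\<^sup>2"
    by (simp only: of_real_eq_iff)
  also have "\<dots> = (real ((N - 2 * K) choose (c - K)) * fact K * pochhammer (real N - 2 * real K + 2) K)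
     * pochhammer (real a - real K + 1) K * pochhammer (real b - real K + 1) K * (M_norm A i \<phi>)\<^sup>2 * (M_norm B j \<psi>)\<^sup>2"
    unfolding sum_lead_hahn_square by (simp add: N_def mult_ac)
  also have "\<dots> = (real (N choose c) * inverse (real (N choose K)) * ((real N - real K + 1) / (real N - 2 * real K + 1))
    * pochhammer (real c - real K + 1) K * pochhammer (real N - real c - real K + 1) K)
    * pochhammer (real a - real K + 1) K * pochhammer (real b - real K + 1) K * (M_norm A i \<phi>)\<^sup>2 * (M_norm B j \<psi>)\<^sup>2"
    unfolding hahn_norm_quotient[OF Kc] ..
  finally show ?thesis by (simp only: mult_ac)
qed

end

section \<open>Equivariance\<close>

lemma zeta_perm_act:
  assumes "bij \<pi>"
  shows "zeta (perm_act \<pi> F) Z = zeta F (inv \<pi> ` Z)"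
proof -
  have inj: "inj (inv \<pi>)" using assms by (simp add: bij_imp_bij_inv bij_is_inj)
  have "Pow (inv \<pi> ` Z) = image (inv \<pi>) ` Pow Z" by (simp add: image_Pow_surj)
  then show ?thesis unfolding zeta_def perm_act_def
    by (simp add: sum.reindex inj_on_def inj_image_eq_iff[OF inj])
qed

text \<open>
  Stated for arbitrary permutations preserving \<open>X\<close>, not just those supported on \<open>X\<close>, because an element of the
  stabilizer of \<open>A\<close> moves points outside \<open>A\<close> as well.
\<close>

lemma perm_act_specht:
  assumes \<pi>: "bij \<pi>" "\<pi> ` X = X" and X: "finite X" and f: "f \<in> specht X p"
  shows "perm_act \<pi> f \<in> specht X p"
proof -
  let ?\<rho> = "inv \<pi>"
  have inj: "inj ?\<rho>" using \<pi> by (simp add: bij_imp_bij_inv bij_is_inj)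
  have \<rho>X: "?\<rho> ` X = X" using \<pi> by (metis bij_is_inj inv_f_f image_inv_f_f)
  have sub: "?\<rho> ` C \<subseteq> X \<longleftrightarrow> C \<subseteq> X" for C
    using inj_image_subset_iff[OF inj, of C X] \<rho>X by simp
  have pm: "perm_act \<pi> f \<in> perm_mod X p"
    unfolding perm_mod_def perm_act_def
  proof (intro CollectI allI impI)
    fix C assume "f (?\<rho> ` C) \<noteq> 0"
    then have "?\<rho> ` C \<subseteq> X" "card (?\<rho> ` C) = p" using f by (auto simp: specht_def perm_mod_def)
    then show "C \<subseteq> X \<and> card C = p"
      using sub card_image[OF inj_on_subset[OF inj subset_UNIV], of C] by simp
  qed
  have "d_map X (perm_act \<pi> f) C = d_map X f (?\<rho> ` C)" for C
  proof (cases "C \<subseteq> X")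
    case True
    have "X - ?\<rho> ` C = ?\<rho> ` (X - C)" using \<rho>X image_set_diff[OF inj, of X C] by simp
    then show ?thesis using True sub[of C]
      by (simp add: d_map_apply[OF X] perm_act_def sum.reindex[OF inj_on_subset[OF inj subset_UNIV]])
  qed (simp add: d_map_apply[OF X] sub)
  then have "d_map X (perm_act \<pi> f) = 0" using f by (simp add: specht_def fun_eq_iff)
  then show ?thesis using pm by (simp add: specht_def)
qed

lemma inv_image_Int:
  assumes "bij \<pi>" "\<pi> ` X = X"
  shows "inv \<pi> ` Z \<inter> X = inv \<pi> ` (Z \<inter> X)"
proof -
  have inj: "inj (inv \<pi>)" using assms by (simp add: bij_imp_bij_inv bij_is_inj)
  have "inv \<pi> ` X = X" using assms by (metis bij_is_inj inv_f_f image_inv_f_f)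
  then show ?thesis using image_Int[OF inj, of Z X] by simp
qed

lemma perm_act_tensor_stabilizer:
  assumes \<pi>: "bij \<pi>" "\<pi> ` A = A" "\<pi> ` B = B"
  shows "perm_act \<pi> (tensor A p B q F G) = tensor A p B q (perm_act \<pi> F) (perm_act \<pi> G)"
proof -
  have inj: "inj (inv \<pi>)" using \<pi> by (simp add: bij_imp_bij_inv bij_is_inj)
  have sub: "inv \<pi> ` Z \<subseteq> A \<union> B \<longleftrightarrow> Z \<subseteq> A \<union> B" for Z
  proof -
    have "inv \<pi> ` (A \<union> B) = A \<union> B" using \<pi> by (metis bij_is_inj inv_f_f image_inv_f_f image_Un)
    then show ?thesis using inj_image_subset_iff[OF inj, of Z "A \<union> B"] by simp
  qed
  have card: "card (inv \<pi> ` Z) = card Z" for Z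
    by (rule card_image[OF inj_on_subset[OF inj subset_UNIV]])
  show ?thesis
    unfolding perm_act_def tensor_def
    by (rule ext) (simp add: inv_image_Int[OF \<pi>(1,2)] inv_image_Int[OF \<pi>(1,3)] sub card)
qed

lemma perm_act_linear: "linear_map_on UNIV (perm_act \<pi>)"
  by (auto simp: linear_map_on_def perm_act_def fscale_def)

lemma perm_act_specht_tensor:
  assumes \<pi>: "bij \<pi>" "\<pi> ` A = A" "\<pi> ` B = B" and fin: "finite A" "finite B"
    and F: "F \<in> specht_tensor A i B j"
  shows "perm_act \<pi> F \<in> specht_tensor A i B j"
proof -
  let ?S = "{tensor A i B j \<phi> \<psi> | \<phi> \<psi>. \<phi> \<in> specht A i \<and> \<psi> \<in> specht B j}"
  have "fun_vs.subspace {F. perm_act \<pi> F \<in> fun_vs.span ?S}"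
    by (rule subspace_preimage[OF perm_act_linear fun_vs.subspace_span])
  moreover have "?S \<subseteq> {F. perm_act \<pi> F \<in> fun_vs.span ?S}"
  proof
    fix F assume "F \<in> ?S"
    then obtain \<phi> \<psi> where F: "F = tensor A i B j \<phi> \<psi>" "\<phi> \<in> specht A i" "\<psi> \<in> specht B j" by blast
    have "perm_act \<pi> F = tensor A i B j (perm_act \<pi> \<phi>) (perm_act \<pi> \<psi>)"
      unfolding F(1) by (rule perm_act_tensor_stabilizer[OF \<pi>])
    then have "perm_act \<pi> F \<in> ?S"
      using perm_act_specht[OF \<pi>(1,2) fin(1) F(2)] perm_act_specht[OF \<pi>(1,3) fin(2) F(3)] by blast
    then have "perm_act \<pi> F \<in> fun_vs.span ?S" by (rule fun_vs.span_base)
    then show "F \<in> {F. perm_act \<pi> F \<in> fun_vs.span ?S}" by (simp only: mem_Collect_eq)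
  qed
  ultimately have "fun_vs.span ?S \<subseteq> {F. perm_act \<pi> F \<in> fun_vs.span ?S}"
    by (intro fun_vs.span_minimal)
  then show ?thesis using F by (auto simp: specht_tensor_def)
qed

lemma perm_act_intertwiner:
  assumes \<pi>: "bij \<pi>" "\<pi> ` A = A" "\<pi> ` B = B"
  shows "intertwiner A i B j k m (perm_act \<pi> F) = perm_act \<pi> (intertwiner A i B j k m F)"
proof -
  have inj: "inj (inv \<pi>)" using \<pi> by (simp add: bij_imp_bij_inv bij_is_inj)
  have sub: "inv \<pi> ` Z \<subseteq> A \<union> B \<longleftrightarrow> Z \<subseteq> A \<union> B" for Z
  proof -
    have "inv \<pi> ` (A \<union> B) = A \<union> B" using \<pi> by (metis bij_is_inj inv_f_f image_inv_f_f image_Un)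
    then show ?thesis using inj_image_subset_iff[OF inj, of Z "A \<union> B"] by simp
  qed
  have card: "card (inv \<pi> ` Z) = card Z" for Z
    by (rule card_image[OF inj_on_subset[OF inj subset_UNIV]])
  show ?thesis
    unfolding intertwiner_def zeta_perm_act[OF \<pi>(1)]
    by (rule ext) (simp add: perm_act_def inv_image_Int[OF \<pi>(1,3)] sub card)
qed

section \<open>The branching theorem\<close>

text \<open>
  A linear map is determined by its values on the spanning tensors, where \<open>T\<^sub>m\<close> agrees with the operator given by
  subset sums. So the latter proves existence, and statements about any \<open>T\<^sub>m\<close> may be proved for it.
\<close>

lemma is_T_iff:
  fixes n h k i j m :: nat
  assumes b: "branching {1..h} {h+1..n} i j k" and h: "h \<le> n" and m: "i \<le> m"
  shows "is_T n h k i j m T \<longleftrightarrow>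
    (\<forall>F\<in>specht_tensor {1..h} i {h+1..n} j. T F = intertwiner {1..h} i {h+1..n} j k m F)"
    (is "_ \<longleftrightarrow> (\<forall>F\<in>?V. T F = ?U F)")
proof
  let ?A = "{1..h}" and ?B = "{h+1..n}"
  let ?S = "{tensor ?A i ?B j \<phi> \<psi> | \<phi> \<psi>. \<phi> \<in> specht ?A i \<and> \<psi> \<in> specht ?B j}"
  have X: "?A \<union> ?B = {1..n}" using h by auto
  have V: "?V = fun_vs.span ?S" by (simp add: specht_tensor_def)
  have lin: "linear_map_on ?V ?U"
    using intertwiner_linear[of ?A i ?B j k m] by (simp add: linear_map_on_def)
  have sub: "fun_vs.subspace ?V" unfolding V by (rule fun_vs.subspace_span)
  have formula: "?U (tensor ?A i ?B j \<phi> \<psi>) =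
      (\<Sum>w = max j (m + i - h)..min (n - h - j) (m - i).
        fscale (of_int (hahn (k - i - j) (n - h - 2 * j) (h - 2 * i) (m - i - j) (w - j)))
          (tensor ?A (m - w) ?B w (R_map ?A (m - w - i) \<phi>) (R_map ?B (w - j) \<psi>)))"
    if "\<phi> \<in> specht ?A i" "\<psi> \<in> specht ?B j" for \<phi> \<psi>
    using branching.intertwiner_tensor[OF b that m] by simp
  show "\<forall>F\<in>?V. T F = ?U F" if T: "is_T n h k i j m T"
  proof
    fix F assume "F \<in> ?V"
    then show "T F = ?U F" unfolding V
    proof (rule linear_maps_eq_on_span[rotated 3])
      show "linear_map_on (fun_vs.span ?S) T" using T unfolding is_T_def Let_def V by (elim conjE)
      show "linear_map_on (fun_vs.span ?S) ?U" using lin unfolding V .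
      fix f assume "f \<in> ?S"
      then obtain \<phi> \<psi> where f: "f = tensor ?A i ?B j \<phi> \<psi>" "\<phi> \<in> specht ?A i" "\<psi> \<in> specht ?B j" by blast
      have "\<forall>\<phi>\<in>specht ?A i. \<forall>\<psi>\<in>specht ?B j. T (tensor ?A i ?B j \<phi> \<psi>) =
        (\<Sum>w = max j (m + i - h)..min (n - h - j) (m - i).
          fscale (of_int (hahn (k - i - j) (n - h - 2 * j) (h - 2 * i) (m - i - j) (w - j)))
            (tensor ?A (m - w) ?B w (R_map ?A (m - w - i) \<phi>) (R_map ?B (w - j) \<psi>)))"
        using T unfolding is_T_def Let_def by (elim conjE)
      from bspec[OF bspec[OF this f(2)] f(3)] show "T f = ?U f"
        unfolding f(1) formula[OF f(2,3)] .
    qed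
  qed
  show "is_T n h k i j m T" if U: "\<forall>F\<in>?V. T F = ?U F"
    unfolding is_T_def Let_def
  proof (intro conjI ballI)
    show "T ` ?V \<subseteq> perm_mod {1..n} m"
      using U intertwiner_in_perm_mod[of ?A i ?B j k m] unfolding X by (intro image_subsetI) simp
    show "linear_map_on ?V T"
      unfolding linear_map_on_def
    proof (intro conjI ballI allI)
      fix f g assume f: "f \<in> ?V" and g: "g \<in> ?V"
      show "T (f + g) = T f + T g"
        unfolding bspec[OF U f] bspec[OF U g] bspec[OF U fun_vs.subspace_add[OF sub f g]]
        using lin f g unfolding linear_map_on_def by blast
    next
      fix c f assume f: "f \<in> ?V"
      show "T (fscale c f) = fscale c (T f)"
        unfolding bspec[OF U f] bspec[OF U fun_vs.subspace_scale[OF sub f]]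
        using lin f unfolding linear_map_on_def by blast
    qed
    fix \<phi> \<psi> assume p: "\<phi> \<in> specht ?A i" "\<psi> \<in> specht ?B j"
    then have "tensor ?A i ?B j \<phi> \<psi> \<in> ?V" unfolding V by (intro fun_vs.span_base) blast
    then show "T (tensor ?A i ?B j \<phi> \<psi>) = (\<Sum>w = max j (m + i - h)..min (n - h - j) (m - i).
        fscale (of_int (hahn (k - i - j) (n - h - 2 * j) (h - 2 * i) (m - i - j) (w - j)))
          (tensor ?A (m - w) ?B w (R_map ?A (m - w - i) \<phi>) (R_map ?B (w - j) \<psi>)))"
      unfolding formula[OF p, symmetric] using U by (rule bspec[rotated])
  qed
qed

theorem theorem2p6:
  fixes n m h k i j :: nat and A B :: "nat set"
  assumes "m \<le> n" and "h \<le> n" and "k \<le> min (n - m) m"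
    and "2 * i \<le> h" and "2 * j \<le> n - h"
    and "int k - int h \<le> int j - int i" and "int j - int i \<le> int n - int h - int k"
    and "i + j \<le> k"
    and "A = {1..h}" and "B = {h+1..n}"
  shows "(\<exists>T. is_T n h k i j m T) \<and>
    (\<forall>T. is_T n h k i j m T \<longrightarrow>
      inj_on T (specht_tensor A i B j) \<and>
      (\<forall>\<pi>\<in>set_stabilizer {1..n} A. \<forall>F\<in>specht_tensor A i B j.
         perm_act \<pi> F \<in> specht_tensor A i B j \<and> T (perm_act \<pi> F) = perm_act \<pi> (T F)) \<and>
      T ` specht_tensor A i B j \<subseteq> R_map {1..n} (m - k) ` specht {1..n} k \<and>
      (\<forall>\<phi>\<in>specht A i. \<forall>\<psi>\<in>specht B j.
         (M_norm {1..n} m (T (tensor A i B j \<phi> \<psi>)))\<^sup>2 =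
           real ((n - 2 * i - 2 * j) choose (m - i - j))
           * inverse (real ((n - 2 * i - 2 * j) choose (k - i - j)))
           * ((real n - real i - real j - real k + 1) / (real n - 2 * real k + 1))
           * pochhammer (real n - real h - real j - real k + real i + 1) (k - i - j)
           * pochhammer (real h - real i - real k + real j + 1) (k - i - j)
           * pochhammer (real m - real k + 1) (k - i - j)
           * pochhammer (real n - real m - real k + 1) (k - i - j)
           * (M_norm A i \<phi>)\<^sup>2 * (M_norm B j \<psi>)\<^sup>2) \<and>
      (\<forall>q T'. m + q \<le> n - k \<and> is_T n h k i j (m + q) T' \<longrightarrow>
         (\<forall>F\<in>specht_tensor A i B j.
            R_map {1..n} q (T F) = fscale (of_nat ((m - k + q) choose q)) (T' F))))"
proof -
  note A = \<open>A = {1..h}\<close> and B = \<open>B = {h+1..n}\<close>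
  have X: "A \<union> B = {1..n}" using assms(2) by (auto simp: A B)
  have cA: "card A = h" and cB: "card B = n - h" by (simp_all add: A B)
  have ineq: "k + i \<le> h + j" "k + j \<le> n - h + i" "k \<le> m" "m + k \<le> n" "i \<le> m"
    using assms(1-8) by linarith+
  interpret branching A B i j k
    by unfold_locales (use assms(4,5,8) ineq in \<open>auto simp: A B\<close>)
  let ?V = "specht_tensor A i B j"
  note iff = is_T_iff[OF branching_axioms[unfolded A B] assms(2), folded A B]
  have V: "fun_vs.subspace ?V" unfolding specht_tensor_def by (rule fun_vs.subspace_span)
  show ?thesis
  proof (intro conjI allI impI)
    show "\<exists>T. is_T n h k i j m T" using iff[OF ineq(5)] by blast
  next
    fix T' assume "is_T n h k i j m T'"
    then have T': "T' F = intertwiner A i B j k m F" if "F \<in> ?V" for F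
      using iff[OF ineq(5)] that by blast
    show "inj_on T' ?V"
    proof (rule inj_onI)
      fix F G assume FG: "F \<in> ?V" "G \<in> ?V" "T' F = T' G"
      have D: "F - G \<in> ?V" using fun_vs.subspace_diff[OF V FG(1,2)] .
      have "intertwiner A i B j k m ((F - G) + G) = intertwiner A i B j k m (F - G) + intertwiner A i B j k m G"
        using intertwiner_linear[of A i B j k m] unfolding linear_map_on_def by blast
      then have "intertwiner A i B j k m F = intertwiner A i B j k m (F - G) + intertwiner A i B j k m G"
        unfolding diff_add_cancel .
      moreover have "intertwiner A i B j k m F = intertwiner A i B j k m G"
        using FG(3) unfolding T'[OF FG(1)] T'[OF FG(2)] .
      ultimately have "intertwiner A i B j k m (F - G) = 0" by (metis add_cancel_left_left)
      then have "F - G = 0"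
        using intertwiner_eq_0_imp[OF D ineq(3)] ineq(4) unfolding X by simp
      then show "F = G" by (metis eq_iff_diff_eq_0)
    qed
    show "\<forall>\<pi>\<in>set_stabilizer {1..n} A. \<forall>F\<in>?V. perm_act \<pi> F \<in> ?V \<and> T' (perm_act \<pi> F) = perm_act \<pi> (T' F)"
    proof (intro ballI)
      fix \<pi> F assume \<pi>: "\<pi> \<in> set_stabilizer {1..n} A" and F: "F \<in> ?V"
      have p: "\<pi> permutes {1..n}" and \<pi>A: "\<pi> ` A = A" using \<pi> by (auto simp: set_stabilizer_def)
      have bij: "bij \<pi>" using p by (rule permutes_bij)
      \<comment> \<open>The stabilizer of \<open>A\<close> also preserves the complement \<open>B\<close>.\<close>
      have "B = (A \<union> B) - A" using disjoint by auto
      then have "\<pi> ` B = \<pi> ` (A \<union> B) - \<pi> ` A" using image_set_diff[OF bij_is_inj[OF bij]] by metis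
      also have "\<dots> = (A \<union> B) - A" unfolding \<pi>A unfolding X permutes_image[OF p] ..
      also have "\<dots> = B" using disjoint by auto
      finally have \<pi>B: "\<pi> ` B = B" .
      have V': "perm_act \<pi> F \<in> ?V" by (rule perm_act_specht_tensor[OF bij \<pi>A \<pi>B finite_A finite_B F])
      then show "perm_act \<pi> F \<in> ?V \<and> T' (perm_act \<pi> F) = perm_act \<pi> (T' F)"
        unfolding T'[OF F] T'[OF V'] perm_act_intertwiner[OF bij \<pi>A \<pi>B] by blast
    qed
    show "T' ` ?V \<subseteq> R_map {1..n} (m - k) ` specht {1..n} k"
    proof (rule image_subsetI)
      fix F assume F: "F \<in> ?V"
      show "T' F \<in> R_map {1..n} (m - k) ` specht {1..n} k"
        unfolding T'[OF F] intertwiner_eq_R_map[OF F ineq(3)] X[symmetric]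
        by (rule imageI[OF intertwiner_in_specht[OF F]])
    qed
    show "\<forall>\<phi>\<in>specht A i. \<forall>\<psi>\<in>specht B j.
         (M_norm {1..n} m (T' (tensor A i B j \<phi> \<psi>)))\<^sup>2 =
           real ((n - 2 * i - 2 * j) choose (m - i - j))
           * inverse (real ((n - 2 * i - 2 * j) choose (k - i - j)))
           * ((real n - real i - real j - real k + 1) / (real n - 2 * real k + 1))
           * pochhammer (real n - real h - real j - real k + real i + 1) (k - i - j)
           * pochhammer (real h - real i - real k + real j + 1) (k - i - j)
           * pochhammer (real m - real k + 1) (k - i - j)
           * pochhammer (real n - real m - real k + 1) (k - i - j)
           * (M_norm A i \<phi>)\<^sup>2 * (M_norm B j \<psi>)\<^sup>2"
    proof (intro ballI)
      fix \<phi> \<psi> assume p: "\<phi> \<in> specht A i" "\<psi> \<in> specht B j"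
      have F: "tensor A i B j \<phi> \<psi> \<in> ?V"
        unfolding specht_tensor_def using p by (intro fun_vs.span_base) blast
      have N: "card B - 2 * j + (card A - 2 * i) = n - 2 * i - 2 * j"
        using assms(2,4,5) unfolding cA cB by linarith
      have r: "real (n - 2 * i - 2 * j) = real n - 2 * real i - 2 * real j"
        "real (k - i - j) = real k - real i - real j" "real (m - i - j) = real m - real i - real j"
        "real (n - h - 2 * j) = real n - real h - 2 * real j" "real (h - 2 * i) = real h - 2 * real i"
        using assms(1-5,8) ineq by (auto simp: of_nat_diff)
      \<comment> \<open>These rewrite the norm formula from the parameters \<open>N, a, b, c, K\<close> to those of the statement.\<close>
      have e: "real n - 2 * real i - 2 * real j - (real k - real i - real j) + 1 = real n - real i - real j - real k + 1"
        "real n - 2 * real i - 2 * real j - 2 * (real k - real i - real j) + 1 = real n - 2 * real k + 1"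
        "real n - real h - 2 * real j - (real k - real i - real j) + 1 = real n - real h - real j - real k + real i + 1"
        "real h - 2 * real i - (real k - real i - real j) + 1 = real h - real i - real k + real j + 1"
        "real m - real i - real j - (real k - real i - real j) + 1 = real m - real k + 1"
        "real n - 2 * real i - 2 * real j - (real m - real i - real j) - (real k - real i - real j) + 1 = real n - real m - real k + 1"
        by simp_all
      have m: "m + k \<le> card (A \<union> B)" using ineq(4) unfolding X by simp
      show "(M_norm {1..n} m (T' (tensor A i B j \<phi> \<psi>)))\<^sup>2 =
           real ((n - 2 * i - 2 * j) choose (m - i - j))
           * inverse (real ((n - 2 * i - 2 * j) choose (k - i - j)))
           * ((real n - real i - real j - real k + 1) / (real n - 2 * real k + 1))
           * pochhammer (real n - real h - real j - real k + real i + 1) (k - i - j)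
           * pochhammer (real h - real i - real k + real j + 1) (k - i - j)
           * pochhammer (real m - real k + 1) (k - i - j)
           * pochhammer (real n - real m - real k + 1) (k - i - j)
           * (M_norm A i \<phi>)\<^sup>2 * (M_norm B j \<psi>)\<^sup>2"
        using norm_square_intertwiner[OF p ineq(3) m] unfolding T'[OF F] N unfolding X cA cB r e .
    qed
    fix q T''
    assume "m + q \<le> n - k \<and> is_T n h k i j (m + q) T''"
    then have T'': "T'' F = intertwiner A i B j k (m + q) F" if "F \<in> ?V" for F
      using iff[OF trans_le_add1[OF ineq(5)]] that by blast
    show "\<forall>F\<in>?V. R_map {1..n} q (T' F) = fscale (of_nat ((m - k + q) choose q)) (T'' F)"
    proof
      fix F assume F: "F \<in> ?V"
      have fin: "finite (A \<union> B)" using finite_A finite_B by simp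
      have k: "k \<le> m + q" "m + q - k = m - k + q" using ineq(3) by simp_all
      have "intertwiner A i B j k (m + q) F = R_map (A \<union> B) (m - k + q) (intertwiner A i B j k k F)"
        using intertwiner_eq_R_map[OF F k(1)] unfolding k(2) .
      then show "R_map {1..n} q (T' F) = fscale (of_nat ((m - k + q) choose q)) (T'' F)"
        unfolding T'[OF F] T''[OF F] X[symmetric] intertwiner_eq_R_map[OF F ineq(3)]
        using R_map_R_map[OF fin intertwiner_in_perm_mod] by (simp only:)
    qed
  qed
qed

end
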